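(* Let $(L_t)_{t\ge0}$ be a Lévy process as in the context (with Gaussian variance $\sigma^2\ge0$), whose Lévy density satisfies $\int x^2n(x)\,dx<\infty$, $\int x^6n(x)\,dx<\infty$ and $p\in\mathbb{L}^2(\mathbb{R})$, where $p(x)=x^3n(x)$. Then there is a constant $C$, not depending on $n,\Delta,m$, such that for every cut-off parameter $m\ge1$, $$\mathbb{E}(\|\bar p_m-p\|^2)\le\|p-p_m\|^2+\mathbb{E}(Z_1^6/\Delta)\frac{m}{n\Delta}+C\Big(\Delta^2\int_{-\pi m}^{\pi m}u^2(1+u^2)|p^*(u)|^2\,du+\Delta^2m^3+\Delta^4m^7\Big),$$ where $p_m(x)=\frac1{2\pi}\int_{-\pi m}^{\pi m}e^{-iux}p^*(u)\,du$.
   Context: Under $\int x^2n(x)\,dx<\infty$, $(L_t)$ is a real Lévy process with characteristic function $\mathbb{E}(e^{iuL_t})=\exp\{t(iub-\frac12u^2\sigma^2+\int_{\mathbb{R}}(e^{iux}-1-iux)n(x)\,dx)\}$, where $b=\mathbb{E}L_1$ and $n(\cdot)$ is the Lévy density. Observations: $Z_k=L_{k\Delta}-L_{(k-1)\Delta}$, $1\le k\le n$ (i.i.d.), with sampling step $\Delta>0$. Notation: $f^*(u)=\int e^{iux}f(x)\,dx$; $\|f\|^2=\int|f(x)|^2dx$. Estimators: $\bar p^*(u)=\frac{i}{\Delta}\,\frac1n\sum_{k=1}^n(iZ_k)^3e^{iuZ_k}$ and $\bar p_m(x)=\frac1{2\pi}\int_{-\pi m}^{\pi m}e^{-iux}\bar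 p^*(u)\,du$. *)

theory Defs
  imports "HOL-Probability.Probability"
begin

text \<open>Cadlag paths are not required; stochastic continuity is the weaker, standard requirement.\<close>

locale levy_process = prob_space M for M :: "'a measure" +
  fixes L :: "real \<Rightarrow> 'a \<Rightarrow> real"
  assumes measurable_L: "\<And>t. 0 \<le> t \<Longrightarrow> random_variable borel (L t)"
    and start_zero: "AE \<omega> in M. L 0 \<omega> = 0"
    and indep_increments:
      "\<And>(k::nat) t. 0 \<le> t 0 \<Longrightarrow> (\<And>i. i < k \<Longrightarrow> t i < t (Suc i)) \<Longrightarrow>
         indep_vars (\<lambda>_. borel) (\<lambda>i \<omega>. L (t (Suc i)) \<omega> - L (t i) \<omega>) {..<k}"
    and stationary_increments:
      "\<And>s h. 0 \<le> s \<Longrightarrow> 0 \<le> h \<Longrightarrow>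
         distr M borel (\<lambda>\<omega>. L (s + h) \<omega> - L s \<omega>) = distr M borel (L h)"
    and stochastically_continuous:
      "\<And>s \<epsilon>. 0 \<le> s \<Longrightarrow> 0 < \<epsilon> \<Longrightarrow>
         ((\<lambda>t. prob {\<omega> \<in> space M. \<epsilon> < \<bar>L t \<omega> - L s \<omega>\<bar>}) \<longlongrightarrow> 0) (at s within {0..})"

text \<open>Levy-Khintchine exponent in the form with fully compensated jumps, which is available when
  \<open>x\<^sup>2 \<nu>(x)\<close> is integrable; then \<open>b\<close> is the mean of the process at time 1.\<close>

definition levy_exponent :: "real \<Rightarrow> real \<Rightarrow> (real \<Rightarrow> real) \<Rightarrow> real \<Rightarrow> complex" where
  "levy_exponent b \<sigma> \<nu> u =
     \<i> * of_real (u * b) - of_real (u\<^sup>2 * \<sigma>\<^sup>2 / 2)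
     + (\<integral>x. (iexp (u * x) - 1 - \<i> * of_real (u * x)) * of_real (\<nu> x) \<partial>lborel)"

definition fourier :: "(real \<Rightarrow> complex) \<Rightarrow> real \<Rightarrow> complex" where
  "fourier f u = (\<integral>x. iexp (u * x) * f x \<partial>lborel)"

definition fourier_inv_cutoff :: "real \<Rightarrow> (real \<Rightarrow> complex) \<Rightarrow> real \<Rightarrow> complex" where
  "fourier_inv_cutoff m g x =
     of_real (1 / (2 * pi)) * (CLBINT u:{- pi * m..pi * m}. iexp (- (u * x)) * g u)"

text \<open>The squared \<open>L\<^sup>2\<close> norm, with value \<open>\<infinity>\<close> when the function is not square integrable.\<close>

definition L2_norm_sq :: "(real \<Rightarrow> complex) \<Rightarrow> ennreal" where
  "L2_norm_sq f = (\<integral>\<^sup>+x. ennreal ((cmod (f x))\<^sup>2) \<partial>lborel)"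

definition increment :: "(real \<Rightarrow> 'a \<Rightarrow> real) \<Rightarrow> real \<Rightarrow> nat \<Rightarrow> 'a \<Rightarrow> real" where
  "increment L \<Delta> k \<omega> = L (real k * \<Delta>) \<omega> - L ((real k - 1) * \<Delta>) \<omega>"

definition pbar_star :: "(real \<Rightarrow> 'a \<Rightarrow> real) \<Rightarrow> real \<Rightarrow> nat \<Rightarrow> 'a \<Rightarrow> real \<Rightarrow> complex" where
  "pbar_star L \<Delta> n \<omega> u =
     (\<i> / of_real \<Delta>) * (1 / of_nat n) *
     (\<Sum>k = 1..n. (\<i> * of_real (increment L \<Delta> k \<omega>)) ^ 3 * iexp (u * increment L \<Delta> k \<omega>))"

definition pbar :: "(real \<Rightarrow> 'a \<Rightarrow> real) \<Rightarrow> real \<Rightarrow> nat \<Rightarrow> real \<Rightarrow> 'a \<Rightarrow> real \<Rightarrow> complex" where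
  "pbar L \<Delta> n m \<omega> = fourier_inv_cutoff m (pbar_star L \<Delta> n \<omega>)"

end

theory Submission
  imports Defs
begin

text \<open>
  Write \<open>\<psi>\<close> for the Levy exponent, \<open>\<phi> = exp (\<Delta> \<psi>)\<close> for the characteristic function of one increment \<open>Z\<close>
  and \<open>p*\<close> for the Fourier transform of \<open>p\<close>. Three ideas give the risk bound.

  Geometry. Inverting a Fourier transform on the band from \<open>- pi * m\<close> to \<open>pi * m\<close> gives functions orthogonal to
  the part of \<open>p\<close> outside the band. Hence the squared error splits, for every outcome, into the squared
  distance of \<open>p\<close> to its own cut-off version and \<open>1 / (2 * pi)\<close> times the integral over the band of the squared
  modulus of the error of the estimator of \<open>p*\<close> (\<open>L2_norm_sq_dist_fourier_inv_cutoff\<close>). This rests on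
  Plancherel's identity for bounded integrable functions continuous almost everywhere (\<open>fourier_plancherel\<close>), which is
  obtained by Gaussian damping.

  Variance. At a fixed frequency the estimator is a mean of \<open>n\<close> independent identically distributed
  terms with second moment \<open>E Z^6 / \<Delta>\<^sup>2\<close>, so the mean square error is at most \<open>E Z^6 / (n \<Delta>\<^sup>2)\<close> plus the squared
  bias (\<open>mean_square_error_sample_mean\<close>), and integrating over the band, of length \<open>2 * pi * m\<close>, produces the variance term.
  That \<open>Z\<close> has a sixth moment is itself a consequence of the moments of \<open>\<nu>\<close>: they make \<open>\<psi>\<close>, hence
  \<open>\<phi>\<close>, six times continuously differentiable, and a characteristic function that is \<open>2 * j\<close> times continuously
  differentiable belongs to a distribution with a moment of order \<open>2 * j\<close> (\<open>Ck_char_imp_moment\<close>).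

  Bias. The mean of the estimator is \<open>\<i> / \<Delta>\<close> times the third derivative of \<open>\<phi>\<close>. Differentiating
  \<open>exp (\<Delta> \<psi>)\<close> three times gives \<open>\<Delta> \<psi>''' \<phi>\<close>, which contributes \<open>p* \<phi>\<close>, and two terms with further factors
  \<open>\<Delta>\<close>. As \<open>\<psi>'\<close> grows linearly and \<open>\<psi>''\<close> is bounded, \<open>\<phi> - 1\<close> is of order
  \<open>\<Delta> \<bar>u\<bar> (1 + \<bar>u\<bar>)\<close> and the two remaining terms are of order \<open>\<Delta> (1 + \<bar>u\<bar>)\<close> and \<open>\<Delta>\<^sup>2 (1 + \<bar>u\<bar>)\<^sup>3\<close> (\<open>levy_bias_bound\<close>). Squared and integrated over
  the band they give the three bias terms of the theorem.
\<close>

section \<open>Smoothness of Fourier integrals\<close>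

text \<open>Dominated convergence applied to the difference quotients: by the mean value theorem they inherit
  the bound \<open>w\<close> on the derivative. A bound near the single point \<open>u0\<close> is all that is
  asked for, because the Levy exponent has a derivative whose integrand grows linearly in \<open>u\<close>.\<close>

lemma has_vector_derivative_integral:
  fixes f :: "real \<Rightarrow> 'b \<Rightarrow> complex"
  assumes int: "\<And>u. integrable M (f u)"
    and der: "\<And>u x. x \<in> space M \<Longrightarrow> ((\<lambda>u. f u x) has_vector_derivative f' u x) (at u)"
    and bnd: "\<And>u x. \<bar>u - u0\<bar> \<le> 1 \<Longrightarrow> x \<in> space M \<Longrightarrow> norm (f' u x) \<le> w x"
    and meas[measurable]: "f' u0 \<in> borel_measurable M"
    and w: "integrable M w"
  shows "((\<lambda>u. \<integral>x. f u x \<partial>M) has_vector_derivative (\<integral>x. f' u0 x \<partial>M)) (at u0)"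
proof -
  have f'int: "integrable M (f' u0)"
    by (rule Bochner_Integration.integrable_bound[OF w])
       (use bnd[of u0] in \<open>auto intro!: AE_I2 simp: order.trans[OF _ abs_ge_self]\<close>)
  \<comment> \<open>\<open>Q y x\<close> is the error term in the definition of the derivative; \<open>2 * w\<close> dominates it, one \<open>w\<close> for each of its two parts.\<close>
  define Q where "Q y x = (1 / norm (y - u0)) *\<^sub>R (f y x - (f u0 x + (y - u0) *\<^sub>R f' u0 x))" for y x
  have Qint: "(\<integral>x. Q y x \<partial>M) = (1 / norm (y - u0)) *\<^sub>R
     ((\<integral>x. f y x \<partial>M) - ((\<integral>x. f u0 x \<partial>M) + (y - u0) *\<^sub>R (\<integral>x. f' u0 x \<partial>M)))" for y
    unfolding Q_def using int f'int by simp
  have Qlim: "((\<lambda>y. Q y x) \<longlongrightarrow> 0) (at u0)" if "x \<in> space M" for x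
    using der[OF that, of u0] unfolding has_vector_derivative_def has_derivative_within Q_def by simp
  have Qbnd: "norm (Q y x) \<le> 2 * w x" if "\<bar>y - u0\<bar> \<le> 1" "x \<in> space M" for y x
  proof (cases "y = u0")
    case True
    have "0 \<le> w x" using bnd[of u0 x] that by (auto intro: order.trans[OF norm_ge_zero])
    then show ?thesis using True by (simp add: Q_def)
  next
    case False
    have A: "norm (f y x - f u0 x) \<le> w x * norm (y - u0)"
    proof (rule differentiable_bound[where S="cball u0 1" and f="\<lambda>u. f u x" and f'="\<lambda>u h. h *\<^sub>R f' u x"])
      show "((\<lambda>u. f u x) has_derivative (\<lambda>h. h *\<^sub>R f' z x)) (at z within cball u0 1)"
        if "z \<in> cball u0 1" for z
        using der[OF \<open>x \<in> space M\<close>, of z] unfolding has_vector_derivative_def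
        by (rule has_derivative_at_withinI)
      show "onorm (\<lambda>h. h *\<^sub>R f' z x) \<le> w x" if "z \<in> cball u0 1" for z
        by (rule onorm_le)
           (use bnd[of z x] that \<open>x \<in> space M\<close> in \<open>auto simp: dist_real_def abs_minus_commute mult.commute intro: mult_left_mono\<close>)
    qed (use that in \<open>auto simp: dist_real_def\<close>)
    have B: "norm ((y - u0) *\<^sub>R f' u0 x) \<le> w x * norm (y - u0)"
      using mult_left_mono[OF bnd[of u0 x], of "\<bar>y - u0\<bar>"] that by (simp add: mult.commute)
    have "norm (f y x - (f u0 x + (y - u0) *\<^sub>R f' u0 x)) \<le> 2 * w x * norm (y - u0)"
      using norm_triangle_ineq4[of "f y x - f u0 x" "(y - u0) *\<^sub>R f' u0 x"] A B
      by (simp add: algebra_simps)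
    with False have "norm (f y x - (f u0 x + (y - u0) *\<^sub>R f' u0 x)) / norm (y - u0) \<le> 2 * w x"
      by (subst pos_divide_le_eq) auto
    then show ?thesis unfolding Q_def norm_scaleR by simp
  qed
  have [measurable]: "f u \<in> borel_measurable M" for u using int by auto
  have Qm [measurable]: "Q y \<in> borel_measurable M" for y unfolding Q_def by measurable
  have lim: "((\<lambda>y. \<integral>x. Q y x \<partial>M) \<longlongrightarrow> 0) (at u0)"
  proof (unfold tendsto_at_iff_sequentially)
    show "\<forall>X. (\<forall>i. X i \<in> UNIV - {u0}) \<longrightarrow> X \<longlonglongrightarrow> u0 \<longrightarrow> ((\<lambda>y. \<integral>x. Q y x \<partial>M) \<circ> X) \<longlonglongrightarrow> 0"
    proof (intro allI impI)
      fix X :: "nat \<Rightarrow> real" assume X: "\<forall>i. X i \<in> UNIV - {u0}" "X \<longlonglongrightarrow> u0"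
      then have fl: "filterlim X (at u0) sequentially" by (auto simp: filterlim_at)
      obtain N where N: "\<And>n. n \<ge> N \<Longrightarrow> \<bar>X n - u0\<bar> < 1"
        using LIMSEQ_D[OF X(2), of 1] by auto
      have "(\<lambda>i. \<integral>x. Q (X (i + N)) x \<partial>M) \<longlonglongrightarrow> (\<integral>x. 0 \<partial>M)"
      proof (rule integral_dominated_convergence[where w="\<lambda>x. 2 * w x"])
        show "AE x in M. (\<lambda>i. Q (X (i + N)) x) \<longlonglongrightarrow> 0"
        proof (rule AE_I2)
          fix x assume "x \<in> space M"
          from filterlim_compose[OF Qlim[OF this] fl]
          show "(\<lambda>i. Q (X (i + N)) x) \<longlonglongrightarrow> 0" by (rule LIMSEQ_ignore_initial_segment)
        qed
        show "AE x in M. norm (Q (X (i + N)) x) \<le> 2 * w x" for i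
          using N[of "i + N"] by (intro AE_I2 Qbnd) auto
      qed (use w in auto)
      then have "(\<lambda>i. \<integral>x. Q (X (i + N)) x \<partial>M) \<longlonglongrightarrow> 0" by simp
      then show "((\<lambda>y. \<integral>x. Q y x \<partial>M) \<circ> X) \<longlonglongrightarrow> 0"
        unfolding comp_def by (rule LIMSEQ_offset)
    qed
  qed
  show ?thesis
    unfolding has_vector_derivative_def has_derivative_within
    using lim unfolding Qint by (simp add: bounded_linear_scaleR_left)
qed

lemma continuous_on_integral_iexp:
  fixes c :: "real \<Rightarrow> complex"
  assumes [measurable_cong]: "sets M = sets borel" and c: "integrable M c"
  shows "continuous_on UNIV (\<lambda>u. \<integral>x. iexp (u * x) * c x \<partial>M)"
  unfolding continuous_on_eq_continuous_at[OF open_UNIV]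
proof (intro ballI)
  fix u :: real
  have [measurable]: "c \<in> borel_measurable M" using c by auto
  show "isCont (\<lambda>u. \<integral>x. iexp (u * x) * c x \<partial>M) u"
    unfolding continuous_at_sequentially
  proof safe
    fix X assume X: "X \<longlonglongrightarrow> u"
    have "(\<lambda>n. \<integral>x. iexp (X n * x) * c x \<partial>M) \<longlonglongrightarrow> (\<integral>x. iexp (u * x) * c x \<partial>M)"
    proof (rule integral_dominated_convergence[where w="\<lambda>x. norm (c x)"])
      show "AE x in M. (\<lambda>n. iexp (X n * x) * c x) \<longlonglongrightarrow> iexp (u * x) * c x"
        by (auto intro!: AE_I2 tendsto_intros X)
    qed (use c in \<open>auto simp: norm_mult simp del: of_real_mult\<close>)
    then show "((\<lambda>u. \<integral>x. iexp (u * x) * c x \<partial>M) \<circ> X) \<longlonglongrightarrow> (\<integral>x. iexp (u * x) * c x \<partial>M)"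
      by (simp add: comp_def)
  qed
qed

lemma has_vector_derivative_iexp_scaled:
  "((\<lambda>u. iexp (u * x)) has_vector_derivative \<i> * of_real x * iexp (u * x)) (at u)"
  by (rule has_vector_derivative_eq_rhs, rule vector_diff_chain_at[unfolded comp_def, where f="\<lambda>u. u * x" and g=iexp])
     (auto intro!: derivative_eq_intros has_vector_derivative_iexp simp: scaleR_conv_of_real)

lemma has_vector_derivative_integral_iexp:
  fixes c :: "real \<Rightarrow> complex"
  assumes M[measurable_cong]: "sets M = sets borel" and c: "integrable M c"
    and xc: "integrable M (\<lambda>x. \<i> * of_real x * c x)"
  shows "((\<lambda>u. \<integral>x. iexp (u * x) * c x \<partial>M) has_vector_derivative
           (\<integral>x. iexp (u * x) * (\<i> * of_real x * c x) \<partial>M)) (at u)"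
proof -
  have [measurable]: "c \<in> borel_measurable M" using c by auto
  show ?thesis
  proof (rule has_vector_derivative_integral[where w="\<lambda>x. norm (\<i> * of_real x * c x)"
        and f="\<lambda>u x. iexp (u * x) * c x" and f'="\<lambda>u x. iexp (u * x) * (\<i> * of_real x * c x)"])
    show "integrable M (\<lambda>x. iexp (u * x) * c x)" for u
      by (rule Bochner_Integration.integrable_bound[OF c]) (auto simp: norm_mult simp del: of_real_mult)
    show "((\<lambda>u. iexp (u * x) * c x) has_vector_derivative iexp (u * x) * (\<i> * of_real x * c x)) (at u)" for u x
      using has_vector_derivative_mult_left[OF has_vector_derivative_iexp_scaled[of x u], of "c x"]
      by (simp add: mult_ac)
    show "integrable M (\<lambda>x. norm (\<i> * of_real x * c x))" using xc by auto
  qed (auto simp: norm_mult simp del: of_real_mult)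
qed

text \<open>\<open>Ck k f\<close>: \<open>f\<close> is \<open>k\<close> times continuously differentiable on the whole line. The recursion asks
  for some derivative instead of naming one, so that closure under sums, products and a linear
  differential equation follows by induction, without Leibniz or Faa di Bruno formulas.\<close>

primrec Ck :: "nat \<Rightarrow> (real \<Rightarrow> complex) \<Rightarrow> bool" where
  "Ck 0 f \<longleftrightarrow> continuous_on UNIV f"
| "Ck (Suc k) f \<longleftrightarrow> (\<exists>f'. (\<forall>u. (f has_vector_derivative f' u) (at u)) \<and> Ck k f')"

lemma Ck_SucI: "(\<And>u. (f has_vector_derivative f' u) (at u)) \<Longrightarrow> Ck k f' \<Longrightarrow> Ck (Suc k) f"
  by auto

lemma Ck_Suc_imp: "Ck (Suc k) f \<Longrightarrow> Ck k f"
proof (induction k arbitrary: f)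
  case 0
  then show ?case
    by (auto simp: continuous_on_eq_continuous_at intro: has_vector_derivative_continuous)
next
  case (Suc k)
  then show ?case by (metis Ck.simps(2))
qed

lemma Ck_const: "Ck k (\<lambda>_. c)"
proof (induction k arbitrary: c)
  case (Suc k)
  then show ?case by (intro Ck_SucI[where f'="\<lambda>_. 0"]) auto
qed auto

lemma Ck_add: "Ck k f \<Longrightarrow> Ck k g \<Longrightarrow> Ck k (\<lambda>u. f u + g u)"
proof (induction k arbitrary: f g)
  case (Suc k)
  then obtain f' g' where "\<forall>u. (f has_vector_derivative f' u) (at u)" "Ck k f'"
    "\<forall>u. (g has_vector_derivative g' u) (at u)" "Ck k g'" by auto
  with Suc.IH show ?case by (intro Ck_SucI[where f'="\<lambda>u. f' u + g' u"]) (auto intro!: derivative_intros)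
qed (auto intro: continuous_intros)

lemma Ck_mult: "Ck k f \<Longrightarrow> Ck k g \<Longrightarrow> Ck k (\<lambda>u. f u * g u)"
proof (induction k arbitrary: f g)
  case (Suc k)
  then obtain f' g' where *: "\<forall>u. (f has_vector_derivative f' u) (at u)" "Ck k f'"
    "\<forall>u. (g has_vector_derivative g' u) (at u)" "Ck k g'" by auto
  have "Ck k f" "Ck k g" using Suc.prems Ck_Suc_imp by auto
  with * Suc.IH show ?case
    by (intro Ck_SucI[where f'="\<lambda>u. f u * g' u + f' u * g u"])
       (auto intro!: has_vector_derivative_mult Ck_add)
qed (auto intro: continuous_intros)

text \<open>A bootstrap: each order of smoothness of \<open>\<phi>\<close> gives the next one through \<open>\<phi>' = a \<phi>\<close>. With
  \<open>a = t \<psi>'\<close> this makes the characteristic function \<open>exp (t \<psi>)\<close> as smooth as its exponent.\<close>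

lemma Ck_linear_ode:
  assumes "\<And>u. (\<phi> has_vector_derivative a u * \<phi> u) (at u)" and "Ck k a"
  shows "Ck (Suc k) \<phi>"
  using assms(2)
proof (induction k)
  case 0
  have "continuous_on UNIV \<phi>"
    using assms(1) by (auto simp: continuous_on_eq_continuous_at intro: has_vector_derivative_continuous)
  with 0 show ?case using assms(1) by (intro Ck_SucI[where f'="\<lambda>u. a u * \<phi> u"]) (auto intro: continuous_intros)
next
  case (Suc k)
  then have "Ck (Suc k) \<phi>" using Ck_Suc_imp by blast
  then show ?case using Ck_SucI[OF assms(1) Ck_mult[OF Suc.prems]] by simp
qed

lemma Ck_integral_iexp:
  fixes c :: "real \<Rightarrow> complex"
  assumes M: "sets M = sets borel"
  shows "(\<And>j. j \<le> k \<Longrightarrow> integrable M (\<lambda>x. (\<i> * of_real x) ^ j * c x)) \<Longrightarrow>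
    Ck k (\<lambda>u. \<integral>x. iexp (u * x) * c x \<partial>M)"
proof (induction k arbitrary: c)
  case 0
  then show ?case using continuous_on_integral_iexp[OF M, of c] by simp
next
  case (Suc k)
  show ?case
  proof (rule Ck_SucI[OF has_vector_derivative_integral_iexp[OF M]])
    show "integrable M c" using Suc.prems[of 0] by simp
    show "integrable M (\<lambda>x. \<i> * of_real x * c x)" using Suc.prems[of 1] by simp
    show "Ck k (\<lambda>u. \<integral>x. iexp (u * x) * (\<i> * of_real x * c x) \<partial>M)"
    proof (rule Suc.IH)
      fix j assume "j \<le> k"
      then show "integrable M (\<lambda>x. (\<i> * of_real x) ^ j * (\<i> * of_real x * c x))"
        using Suc.prems[of "Suc j"] by (simp add: mult_ac)
    qed
  qed
qed

section \<open>Moments from smooth characteristic functions\<close>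

text \<open>Central differences with the undivided step \<open>2 * h\<close>. They are chosen because \<open>\<lambda>u. iexp (u * x)\<close> is an
  eigenfunction with eigenvalue \<open>2 * \<i> * sin (h * x)\<close>, whose even powers are real of constant sign.\<close>

definition sdiff :: "real \<Rightarrow> (real \<Rightarrow> complex) \<Rightarrow> real \<Rightarrow> complex" where
  "sdiff h f u = f (u + h) - f (u - h)"

lemma has_vector_derivative_sdiff:
  assumes "\<And>u. (f has_vector_derivative f' u) (at u)"
  shows "((sdiff h ^^ k) f has_vector_derivative (sdiff h ^^ k) f' u) (at u)"
proof (induction k arbitrary: u)
  case (Suc k)
  let ?g = "(sdiff h ^^ k) f" and ?g' = "(sdiff h ^^ k) f'"
  have shift: "((\<lambda>u. ?g (u + s)) has_vector_derivative ?g' (u + s)) (at u)" for s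
  proof -
    have "((\<lambda>u. u + s) has_vector_derivative 1) (at u)" by (auto intro!: derivative_eq_intros)
    from vector_diff_chain_at[OF this Suc.IH] show ?thesis by (simp add: comp_def)
  qed
  have "((\<lambda>u. ?g (u + h) - ?g (u + - h)) has_vector_derivative ?g' (u + h) - ?g' (u + - h)) (at u)"
    by (intro has_vector_derivative_diff shift)
  then show ?case by (simp add: sdiff_def[abs_def])
qed (use assms in simp)

text \<open>Each difference costs one derivative and gains one factor \<open>2 * h\<close> by the mean value theorem. The
  window \<open>K\<close> has to grow by one in the induction, since a difference at \<open>u\<close> looks at \<open>u + h\<close> and
  \<open>u - h\<close>.\<close>

lemma Ck_sdiff_bound:
  "Ck k f \<Longrightarrow> \<exists>C\<ge>0. \<forall>h u. 0 \<le> h \<longrightarrow> h \<le> 1 \<longrightarrow> \<bar>u\<bar> \<le> K \<longrightarrow> norm ((sdiff h ^^ k) f u) \<le> C * h ^ k"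
proof (induction k arbitrary: f K)
  case 0
  have "bounded (f ` {-K..K})"
    using 0 by (intro compact_imp_bounded compact_continuous_image) (auto intro: continuous_on_subset)
  then obtain C where "\<forall>u\<in>{-K..K}. norm (f u) \<le> C" by (auto simp: bounded_iff)
  then show ?case by (intro exI[of _ "max 0 C"]) (auto simp: abs_le_iff le_max_iff_disj)
next
  case (Suc k)
  then obtain f' where f': "\<And>u. (f has_vector_derivative f' u) (at u)" "Ck k f'" by auto
  from Suc.IH[OF f'(2), of "K + 1"] obtain C where C: "C \<ge> 0"
    "\<And>h u. 0 \<le> h \<Longrightarrow> h \<le> 1 \<Longrightarrow> \<bar>u\<bar> \<le> K + 1 \<Longrightarrow> norm ((sdiff h ^^ k) f' u) \<le> C * h ^ k" by blast
  show ?case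
  proof (intro exI[of _ "2 * C"] conjI allI impI)
    fix h u :: real assume h: "0 \<le> h" "h \<le> 1" and u: "\<bar>u\<bar> \<le> K"
    let ?g = "(sdiff h ^^ k) f" and ?g' = "(sdiff h ^^ k) f'"
    have "norm (?g (u + h) - ?g (u - h)) \<le> C * h ^ k * norm ((u + h) - (u - h))"
    proof (rule differentiable_bound[where S="{-(K+1)..K+1}" and f'="\<lambda>u r. r *\<^sub>R ?g' u"])
      show "(?g has_derivative (\<lambda>r. r *\<^sub>R ?g' z)) (at z within {-(K+1)..K+1})" for z
        using has_vector_derivative_sdiff[OF f'(1)] unfolding has_vector_derivative_def
        by (rule has_derivative_at_withinI)
      show "onorm (\<lambda>r. r *\<^sub>R ?g' z) \<le> C * h ^ k" if "z \<in> {-(K+1)..K+1}" for z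
        by (rule onorm_le) (use C(2)[OF h, of z] that in \<open>auto simp: mult.commute abs_le_iff intro: mult_left_mono\<close>)
    qed (use h u in \<open>auto simp: abs_le_iff\<close>)
    then show "norm ((sdiff h ^^ Suc k) f u) \<le> 2 * C * h ^ Suc k"
      using h by (simp add: sdiff_def mult_ac)
  qed (use C in auto)
qed

lemma (in real_distribution) sdiff_char:
  "(sdiff h ^^ k) (char M) u = (\<integral>x. iexp (u * x) * (2 * \<i> * of_real (sin (h * x))) ^ k \<partial>M)"
proof (induction k arbitrary: u)
  case (Suc k)
  have int: "integrable M (\<lambda>x. iexp (v * x) * (2 * \<i> * of_real (sin (h * x))) ^ k)" for v
  proof (rule integrable_const_bound[where B="2 ^ k"])
    have "(\<bar>sin (h * x)\<bar> * 2) ^ k \<le> 2 ^ k" for x by (intro power_mono) auto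
    then show "AE x in M. norm (iexp (v * x) * (2 * \<i> * of_real (sin (h * x))) ^ k) \<le> 2 ^ k"
      by (auto simp: norm_mult norm_power mult.commute simp del: of_real_mult)
  qed simp
  have eq: "iexp ((u + h) * x) - iexp ((u - h) * x) = iexp (u * x) * (2 * \<i> * of_real (sin (h * x)))" for x
    by (simp add: complex_eq_iff Re_exp Im_exp distrib_right left_diff_distrib cos_add cos_diff sin_add sin_diff)
  have "(sdiff h ^^ Suc k) (char M) u
      = (\<integral>x. iexp ((u + h) * x) * (2 * \<i> * of_real (sin (h * x))) ^ k
            - iexp ((u - h) * x) * (2 * \<i> * of_real (sin (h * x))) ^ k \<partial>M)"
    unfolding funpow.simps comp_apply sdiff_def[of h "(sdiff h ^^ k) (char M)"] Suc.IH
    by (rule Bochner_Integration.integral_diff[OF int int, symmetric])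
  also have "\<dots> = (\<integral>x. iexp (u * x) * (2 * \<i> * of_real (sin (h * x))) ^ Suc k \<partial>M)"
    unfolding left_diff_distrib[symmetric] eq power_Suc by (simp only: mult.assoc)
  finally show ?case .
qed (simp add: char_def)

text \<open>Smoothness of the characteristic function at the origin forces moments. Up to sign, the central
  difference of order \<open>2 * j\<close> at \<open>0\<close> is the expectation of \<open>(2 * sin (h * x)) ^ (2 * j)\<close>, and it is
  \<open>O(h ^ (2 * j))\<close>. Dividing by \<open>h ^ (2 * j)\<close> and letting \<open>h\<close> tend to \<open>0\<close>, Fatou's lemma bounds the
  expectation of \<open>(2 * x) ^ (2 * j)\<close>. Evenness of the order is essential: it makes the integrands
  nonnegative.\<close>

lemma (in real_distribution) Ck_char_imp_moment:
  assumes "Ck (2 * j) (char M)"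
  shows "integrable M (\<lambda>x. x ^ (2 * j))"
proof -
  obtain C where C: "C \<ge> 0"
    "\<And>h. 0 \<le> h \<Longrightarrow> h \<le> 1 \<Longrightarrow> norm ((sdiff h ^^ (2 * j)) (char M) 0) \<le> C * h ^ (2 * j)"
    using Ck_sdiff_bound[OF assms, of 0] by auto
  \<comment> \<open>The integrand of the difference of step \<open>h = 1 / Suc n\<close>, divided by \<open>h ^ (2 * j)\<close>.\<close>
  define s where "s n x = (2 * sin (x / real (Suc n)) * real (Suc n)) ^ (2 * j)" for n x
  have s_int: "integrable M (s n)" for n
  proof (rule integrable_const_bound[where B="(2 * real (Suc n)) ^ (2 * j)"])
    show "AE x in M. norm (s n x) \<le> (2 * real (Suc n)) ^ (2 * j)"
      unfolding s_def norm_power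
      by (intro AE_I2 power_mono) (simp_all add: abs_mult mult_right_mono del: of_nat_Suc)
  qed (simp add: s_def[abs_def])
  have s_nonneg: "s n x \<ge> 0" for n x unfolding s_def by (simp add: power_mult)
  have s_le: "(\<integral>x. s n x \<partial>M) \<le> C" for n
  proof -
    define h where "h = 1 / real (Suc n)"
    have h: "0 < h" "h \<le> 1" by (auto simp: h_def)
    have *: "(2 * \<i> * complex_of_real (sin (h * x))) ^ (2 * j) = (-1) ^ j * of_real ((h ^ (2*j)) * s n x)" for x
    proof -
      have "h ^ (2 * j) * s n x = (h * (2 * sin (h * x) * real (Suc n))) ^ (2 * j)"
        unfolding power_mult_distrib[of h] by (simp add: s_def h_def)
      also have "h * (2 * sin (h * x) * real (Suc n)) = 2 * sin (h * x)" by (simp add: h_def)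
      finally have 1: "h ^ (2 * j) * s n x = (2 * sin (h * x)) ^ (2 * j)" .
      have 2: "(2 * \<i> * complex_of_real (sin (h * x)))\<^sup>2 = (-1) * (of_real (2 * sin (h * x)))\<^sup>2"
        by (simp add: power_mult_distrib)
      show ?thesis
        unfolding 1 unfolding power_mult of_real_power unfolding 2 by (rule power_mult_distrib)
    qed
    have "norm ((sdiff h ^^ (2 * j)) (char M) 0) = h ^ (2 * j) * (\<integral>x. s n x \<partial>M)"
      unfolding sdiff_char * using s_nonneg h
      by (simp add: norm_mult norm_power Bochner_Integration.integral_nonneg)
    with C(2)[of h] h show ?thesis by (simp add: mult.commute)
  qed
  have lim: "(\<lambda>n. s n x) \<longlonglongrightarrow> (2 * x) ^ (2 * j)" for x
  proof -
    have "(\<lambda>n. sin (x / real (Suc n)) * real (Suc n)) \<longlonglongrightarrow> x"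
    proof (cases "x = 0")
      case False
      have "(\<lambda>n. x / real (Suc n)) \<longlonglongrightarrow> 0"
        using LIMSEQ_Suc[OF lim_const_over_n[of x]] by simp
      then have "filterlim (\<lambda>n. x / real (Suc n)) (at 0) sequentially"
        using False by (auto simp: filterlim_at)
      moreover have "((\<lambda>t::real. sin t / t) \<longlongrightarrow> 1) (at 0)"
        using DERIV_sin[of "0::real"] by (simp add: DERIV_def)
      ultimately have "(\<lambda>n. sin (x / real (Suc n)) / (x / real (Suc n))) \<longlonglongrightarrow> 1"
        by (rule filterlim_compose[rotated])
      then have "(\<lambda>n. x * (sin (x / real (Suc n)) / (x / real (Suc n)))) \<longlonglongrightarrow> x * 1"
        by (intro tendsto_intros)
      then show ?thesis using False by (simp del: of_nat_Suc)
    qed simp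
    then have "(\<lambda>n. (2 * (sin (x / real (Suc n)) * real (Suc n))) ^ (2 * j)) \<longlonglongrightarrow> (2 * x) ^ (2 * j)"
      by (intro tendsto_intros)
    then show ?thesis by (simp add: s_def mult_ac)
  qed
  have "(\<integral>\<^sup>+x. ennreal ((2 * x) ^ (2 * j)) \<partial>M) = (\<integral>\<^sup>+x. liminf (\<lambda>n. ennreal (s n x)) \<partial>M)"
    by (intro nn_integral_cong sym[OF lim_imp_Liminf] tendsto_ennrealI lim) simp
  also have "\<dots> \<le> liminf (\<lambda>n. \<integral>\<^sup>+x. ennreal (s n x) \<partial>M)"
    by (rule nn_integral_liminf) (use s_int in \<open>auto intro!: measurable_compose[OF _ measurable_ennreal]\<close>)
  also have "\<dots> \<le> liminf (\<lambda>n. ennreal C)"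
    using s_le by (intro Liminf_mono always_eventually)
      (auto simp: nn_integral_eq_integral[OF s_int] s_nonneg intro!: ennreal_leI)
  also have "\<dots> = ennreal C" by (simp add: Liminf_const)
  finally have "(\<integral>\<^sup>+x. ennreal ((2 * x) ^ (2 * j)) \<partial>M) < \<infinity>"
    by (rule order.strict_trans1) simp
  then have "integrable M (\<lambda>x. (2 * x) ^ (2 * j))"
    by (intro integrableI_nonneg) (auto simp: power_mult)
  then show ?thesis by (simp add: power_mult_distrib)
qed

section \<open>Plancherel's identity\<close>

lemma borel_measurable_cnj [measurable]:
  "f \<in> borel_measurable M \<Longrightarrow> (\<lambda>x. cnj (f x)) \<in> borel_measurable M"
  by (rule measurable_compose[OF _ borel_measurable_continuous_onI]) (auto intro: continuous_intros)

text \<open>The form in which Fubini's theorem is used below, with a character \<open>iexp (u * x)\<close>, or its inverse,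
  as the kernel.\<close>

lemma Fubini_bounded_kernel:
  fixes a b :: "real \<Rightarrow> complex" and k :: "real \<Rightarrow> real \<Rightarrow> complex"
  assumes a: "integrable lborel a" and b: "integrable lborel b"
    and k[measurable]: "case_prod k \<in> borel_measurable (borel \<Otimes>\<^sub>M borel)"
    and k1: "\<And>x y. norm (k x y) \<le> 1"
  shows "(\<integral>x. a x * (\<integral>y. k x y * b y \<partial>lborel) \<partial>lborel) = (\<integral>y. b y * (\<integral>x. k x y * a x \<partial>lborel) \<partial>lborel)"
proof -
  have [measurable]: "a \<in> borel_measurable borel" "b \<in> borel_measurable borel" using a b by auto
  have ab: "integrable (lborel \<Otimes>\<^sub>M lborel) (\<lambda>(x, y). a x * b y)"
  proof (rule lborel_pair.Fubini_integrable)
    show "integrable lborel (\<lambda>x. \<integral>y. norm (case (x, y) of (x, y) \<Rightarrow> a x * b y) \<partial>lborel)"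
      using a by (simp add: norm_mult)
    show "AE x in lborel. integrable lborel (\<lambda>y. case (x, y) of (x, y) \<Rightarrow> a x * b y)"
      using b by simp
  qed measurable
  have "integrable (lborel \<Otimes>\<^sub>M lborel) (\<lambda>(x, y). a x * (k x y * b y))"
  proof (rule Bochner_Integration.integrable_bound[OF ab])
    show "(\<lambda>(x, y). a x * (k x y * b y)) \<in> borel_measurable (lborel \<Otimes>\<^sub>M lborel)"
      by measurable
    show "AE z in lborel \<Otimes>\<^sub>M lborel. norm (case z of (x, y) \<Rightarrow> a x * (k x y * b y))
        \<le> norm (case z of (x, y) \<Rightarrow> a x * b y)"
      by (intro AE_I2) (auto simp: norm_mult intro!: mult_left_mono mult_left_le_one_le k1)
  qed
  from lborel_pair.Fubini_integral[OF this]
  have "(\<integral>y. (\<integral>x. a x * (k x y * b y) \<partial>lborel) \<partial>lborel) = (\<integral>x. (\<integral>y. a x * (k x y * b y) \<partial>lborel) \<partial>lborel)" .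
  moreover have "(\<integral>x. a x * (k x y * b y) \<partial>lborel) = b y * (\<integral>x. k x y * a x \<partial>lborel)" for y
    by (subst integral_mult_right_zero[symmetric]) (simp add: mult_ac)
  ultimately show ?thesis by simp
qed

text \<open>The Gaussian is its own Fourier transform, here read off from the characteristic function of the
  standard normal distribution.\<close>

lemma integral_gaussian_iexp:
  assumes "\<eta> > 0"
  shows "(\<integral>x. iexp (s * x) * of_real (exp (- ((\<eta> * x)\<^sup>2) / 2)) \<partial>lborel)
     = of_real (2 * pi / \<eta> * std_normal_density (s / \<eta>))"
proof -
  have dens: "exp (- (x\<^sup>2) / 2) = sqrt (2 * pi) * std_normal_density x" for x :: real
    by (simp add: std_normal_density_def)
  have "(\<integral>x. iexp (s * x) * of_real (exp (- ((\<eta> * x)\<^sup>2) / 2)) \<partial>lborel)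
     = \<bar>1 / \<eta>\<bar> *\<^sub>R (\<integral>y. iexp (s * (0 + 1 / \<eta> * y)) * of_real (exp (- ((\<eta> * (0 + 1 / \<eta> * y))\<^sup>2) / 2)) \<partial>lborel)"
    using assms by (intro lborel_integral_real_affine) auto
  also have "(\<lambda>y. iexp (s * (0 + 1 / \<eta> * y)) * complex_of_real (exp (- ((\<eta> * (0 + 1 / \<eta> * y))\<^sup>2) / 2)))
     = (\<lambda>y. of_real (sqrt (2 * pi)) * (std_normal_density y *\<^sub>R iexp (s / \<eta> * y)))"
  proof
    fix y
    have "\<eta> * (0 + 1 / \<eta> * y) = y" "s * (0 + 1 / \<eta> * y) = s / \<eta> * y" using assms by auto
    then show "iexp (s * (0 + 1 / \<eta> * y)) * complex_of_real (exp (- ((\<eta> * (0 + 1 / \<eta> * y))\<^sup>2) / 2))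
      = of_real (sqrt (2 * pi)) * (std_normal_density y *\<^sub>R iexp (s / \<eta> * y))"
      by (simp only: dens) (simp add: scaleR_conv_of_real)
  qed
  also have "(\<integral>y. of_real (sqrt (2 * pi)) * (std_normal_density y *\<^sub>R iexp (s / \<eta> * y)) \<partial>lborel)
     = of_real (sqrt (2 * pi)) * char std_normal_distribution (s / \<eta>)"
    unfolding char_def by (subst integral_density) (auto simp flip: integral_mult_right_zero)
  also have "\<dots> = of_real (sqrt (2 * pi) * (sqrt (2 * pi) * std_normal_density (s / \<eta>)))"
    by (simp only: char_std_normal_distribution of_real_mult dens[symmetric])
  finally show ?thesis
    using assms by (simp add: scaleR_conv_of_real mult_ac flip: of_real_mult)
qed

text \<open>Parseval's identity after damping by a Gaussian, which makes the double integrals absolutely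
  convergent. On the frequency side the damping turns one factor \<open>G\<close> into its average over a normal
  distribution of standard deviation \<open>\<eta>\<close> around \<open>u\<close>.\<close>

lemma fourier_gaussian_parseval:
  fixes G :: "real \<Rightarrow> complex"
  assumes G: "integrable lborel G" and \<eta>: "\<eta> > 0"
  defines "F \<equiv> (\<lambda>x. \<integral>u. iexp (- (u * x)) * G u \<partial>lborel)"
  shows "(\<integral>x. of_real (exp (- ((\<eta> * x)\<^sup>2) / 2) * (cmod (F x))\<^sup>2) \<partial>lborel)
     = of_real (2 * pi) * (\<integral>u. G u * (\<integral>w. of_real (std_normal_density w) * cnj (G (u + \<eta> * w)) \<partial>lborel) \<partial>lborel)"
    and "integrable lborel (\<lambda>x. exp (- ((\<eta> * x)\<^sup>2) / 2) * (cmod (F x))\<^sup>2)"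
proof -
  have [measurable]: "G \<in> borel_measurable borel" using G by auto
  have [measurable]: "F \<in> borel_measurable borel"
    unfolding F_def by measurable
  let ?e = "\<lambda>x. exp (- ((\<eta> * x)\<^sup>2) / 2)"
  have F_le: "norm (F x) \<le> (\<integral>u. norm (G u) \<partial>lborel)" for x
    unfolding F_def by (rule order.trans[OF integral_norm_bound]) (simp add: norm_mult del: of_real_mult of_real_minus)
  have e_int: "integrable lborel ?e"
  proof -
    have "integrable lborel (\<lambda>x. sqrt (2 * pi) * std_normal_density (0 + \<eta> * x))"
      using \<eta> by (intro integrable_mult_right lborel_integrable_real_affine integrable_std_normal_moment[of 0, simplified]) auto
    then show ?thesis by (simp add: std_normal_density_def)
  qed
  have F_le2: "(norm (F x))\<^sup>2 \<le> (\<integral>u. norm (G u) \<partial>lborel)\<^sup>2" for x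
    by (intro power_mono F_le) auto
  show "integrable lborel (\<lambda>x. ?e x * (cmod (F x))\<^sup>2)"
  proof (rule Bochner_Integration.integrable_bound)
    show "integrable lborel (\<lambda>x. ?e x * (\<integral>u. norm (G u) \<partial>lborel)\<^sup>2)" using e_int by simp
  qed (use F_le2 in \<open>auto simp: abs_mult intro!: mult_left_mono\<close>)
  have eF_int: "integrable lborel (\<lambda>x. of_real (?e x) * cnj (F x))"
  proof (rule Bochner_Integration.integrable_bound)
    show "integrable lborel (\<lambda>x. ?e x * (\<integral>u. norm (G u) \<partial>lborel))" using e_int by simp
  qed (use order.trans[OF F_le abs_ge_self] in \<open>auto simp: norm_mult abs_mult intro!: mult_left_mono\<close>)
  have Fx: "(\<integral>u. iexp (- (u * x)) * G u \<partial>lborel) = F x" for x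
    unfolding F_def by (rule refl)
  have cnjF: "cnj (F x) = (\<integral>v. iexp (v * x) * cnj (G v) \<partial>lborel)" for x
  proof -
    have "cnj (iexp (- (u * x)) * G u) = iexp (u * x) * cnj (G u)" for u
      by (simp add: exp_cnj)
    then show ?thesis unfolding F_def by (simp only: flip: Bochner_Integration.integral_cnj)
  qed
  have inner: "(\<integral>x. iexp (- (u * x)) * (of_real (?e x) * cnj (F x)) \<partial>lborel)
      = of_real (2 * pi) * (\<integral>w. of_real (std_normal_density w) * cnj (G (u + \<eta> * w)) \<partial>lborel)" for u
  proof -
    have "(\<integral>x. iexp (- (u * x)) * (of_real (?e x) * cnj (F x)) \<partial>lborel)
        = (\<integral>x. (iexp (- (u * x)) * of_real (?e x)) * (\<integral>v. iexp (v * x) * cnj (G v) \<partial>lborel) \<partial>lborel)"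
      by (simp only: cnjF mult.assoc)
    also have "\<dots> = (\<integral>v. cnj (G v) * (\<integral>x. iexp (v * x) * (iexp (- (u * x)) * of_real (?e x)) \<partial>lborel) \<partial>lborel)"
    proof (rule Fubini_bounded_kernel)
      show "integrable lborel (\<lambda>x. iexp (- (u * x)) * of_real (?e x))"
        by (rule Bochner_Integration.integrable_bound[OF e_int])
           (auto simp: norm_mult simp del: of_real_mult of_real_minus)
      show "integrable lborel (\<lambda>v. cnj (G v))" using G by simp
    qed (auto simp del: of_real_mult)
    also have "\<dots> = (\<integral>v. cnj (G v) * of_real (2 * pi / \<eta> * std_normal_density ((v - u) / \<eta>)) \<partial>lborel)"
    proof -
      have "iexp (v * x) * (iexp (- (u * x)) * of_real (?e x)) = iexp ((v - u) * x) * of_real (?e x)" for v x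
      proof -
        have "iexp (v * x) * iexp (- (u * x)) = iexp ((v - u) * x)"
          by (simp add: exp_add[symmetric] algebra_simps)
        then show ?thesis by (simp only: mult.assoc[symmetric])
      qed
      then show ?thesis by (simp only: integral_gaussian_iexp[OF \<eta>])
    qed
    \<comment> \<open>The substitution \<open>v = u + \<eta> * w\<close>.\<close>
    also have "\<dots> = \<bar>\<eta>\<bar> *\<^sub>R (\<integral>w. cnj (G (u + \<eta> * w)) * of_real (2 * pi / \<eta> * std_normal_density ((u + \<eta> * w - u) / \<eta>)) \<partial>lborel)"
      using \<eta> by (intro lborel_integral_real_affine) auto
    also have "\<dots> = of_real (2 * pi) * (\<integral>w. of_real (std_normal_density w) * cnj (G (u + \<eta> * w)) \<partial>lborel)"
      unfolding scaleR_conv_of_real integral_mult_right_zero[symmetric]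
      using \<eta> by (intro Bochner_Integration.integral_cong refl) simp
    finally show ?thesis .
  qed
  have "(\<integral>x. of_real (?e x * (cmod (F x))\<^sup>2) \<partial>lborel)
      = (\<integral>x. (of_real (?e x) * cnj (F x)) * (\<integral>u. iexp (- (u * x)) * G u \<partial>lborel) \<partial>lborel)"
    unfolding Fx by (intro Bochner_Integration.integral_cong refl) (simp only: of_real_mult complex_norm_square mult_ac)
  also have "\<dots> = (\<integral>u. G u * (\<integral>x. iexp (- (u * x)) * (of_real (?e x) * cnj (F x)) \<partial>lborel) \<partial>lborel)"
    by (rule Fubini_bounded_kernel[OF eF_int G]) (auto simp del: of_real_mult of_real_minus)
  also have "\<dots> = of_real (2 * pi) * (\<integral>u. G u * (\<integral>w. of_real (std_normal_density w) * cnj (G (u + \<eta> * w)) \<partial>lborel) \<partial>lborel)"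
    unfolding inner by (simp only: mult.left_commute[of "G _"] integral_mult_right_zero)
  finally show "(\<integral>x. of_real (?e x * (cmod (F x))\<^sup>2) \<partial>lborel) = \<dots>" .
qed

text \<open>Let the damping parameter \<open>\<eta>\<close> tend to \<open>0\<close> in the damped Parseval identity. On the left the
  Gaussian factors increase to \<open>1\<close>, so monotone convergence also yields integrability; on the right
  the Gaussian averages converge at every continuity point of \<open>G\<close>. Continuity only almost everywhere
  is the right generality, as \<open>G\<close> will be a continuous function cut off to an interval.\<close>

lemma fourier_plancherel:
  fixes G :: "real \<Rightarrow> complex"
  assumes G: "integrable lborel G" and bnd: "\<And>u. norm (G u) \<le> B"
    and cont: "AE u in lborel. isCont G u"
  defines "F \<equiv> (\<lambda>x. \<integral>u. iexp (- (u * x)) * G u \<partial>lborel)"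
  shows "integrable lborel (\<lambda>x. (cmod (F x))\<^sup>2)" (is ?int)
    and "(\<integral>x. (cmod (F x))\<^sup>2 \<partial>lborel) = 2 * pi * (\<integral>u. (cmod (G u))\<^sup>2 \<partial>lborel)" (is ?eq)
proof -
  have [measurable]: "G \<in> borel_measurable borel" using G by auto
  define \<eta> where "\<eta> n = 1 / real (Suc n)" for n
  have \<eta>_pos: "\<eta> n > 0" for n by (simp add: \<eta>_def)
  have \<eta>_lim: "\<eta> \<longlonglongrightarrow> 0"
    unfolding \<eta>_def using LIMSEQ_Suc[OF lim_const_over_n[of 1]] by simp
  have [measurable]: "F \<in> borel_measurable borel"
    unfolding F_def by measurable
  let ?d = "std_normal_density"
  have d_int: "integrable lborel ?d"
    using integrable_std_normal_moment[of 0] by simp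
  have d_eq: "(\<integral>w. ?d w \<partial>lborel) = 1"
    using integral_std_normal_moment_even[of 0] by simp
  let ?I = "\<lambda>n u. \<integral>w. of_real (?d w) * cnj (G (u + \<eta> n * w)) \<partial>lborel"
  have B0: "B \<ge> 0" using bnd[of 0] norm_ge_zero order.trans by blast
  have I_lim: "(\<lambda>n. ?I n u) \<longlonglongrightarrow> cnj (G u)" if "isCont G u" for u
  proof -
    have "(\<lambda>n. ?I n u) \<longlonglongrightarrow> (\<integral>w. of_real (?d w) * cnj (G u) \<partial>lborel)"
    proof (rule integral_dominated_convergence[where w="\<lambda>w. ?d w * B"])
      show "AE w in lborel. (\<lambda>n. of_real (?d w) * cnj (G (u + \<eta> n * w))) \<longlonglongrightarrow> of_real (?d w) * cnj (G u)"
      proof (rule AE_I2)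
        fix w
        have "(\<lambda>n. u + \<eta> n * w) \<longlonglongrightarrow> u + 0 * w" by (intro tendsto_intros \<eta>_lim)
        then have "(\<lambda>n. G (u + \<eta> n * w)) \<longlonglongrightarrow> G u"
          using isCont_tendsto_compose[OF that] by simp
        then show "(\<lambda>n. of_real (?d w) * cnj (G (u + \<eta> n * w))) \<longlonglongrightarrow> of_real (?d w) * cnj (G u)"
          by (intro tendsto_intros)
      qed
      show "AE w in lborel. norm (of_real (?d w) * cnj (G (u + \<eta> n * w))) \<le> ?d w * B" for n
        by (intro AE_I2) (auto simp: norm_mult intro!: mult_left_mono bnd)
    qed (use d_int in auto)
    also have "(\<integral>w. of_real (?d w) * cnj (G u) \<partial>lborel) = cnj (G u)"
      using d_eq by simp
    finally show ?thesis .
  qed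
  have I_le: "norm (?I n u) \<le> B" for n u
  proof -
    have "norm (?I n u) \<le> (\<integral>w. ?d w * B \<partial>lborel)"
    proof (rule Bochner_Integration.integral_norm_bound_integral)
      show "integrable lborel (\<lambda>w. of_real (?d w) * cnj (G (u + \<eta> n * w)))"
        by (rule Bochner_Integration.integrable_bound[OF integrable_mult_left[OF d_int, of B]])
           (auto simp: norm_mult B0 intro!: mult_left_mono bnd)
      show "integrable lborel (\<lambda>w. ?d w * B)" using d_int by simp
      show "norm (of_real (?d w) * cnj (G (u + \<eta> n * w))) \<le> ?d w * B" for w
        by (auto simp: norm_mult intro!: mult_left_mono bnd)
    qed
    then show ?thesis using d_eq by simp
  qed
  have "(\<lambda>n. \<integral>u. G u * ?I n u \<partial>lborel) \<longlonglongrightarrow> (\<integral>u. G u * cnj (G u) \<partial>lborel)"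
  proof (rule integral_dominated_convergence[where w="\<lambda>u. norm (G u) * B"])
    show "AE u in lborel. (\<lambda>n. G u * ?I n u) \<longlonglongrightarrow> G u * cnj (G u)"
      using cont by eventually_elim (intro tendsto_intros I_lim)
    show "AE u in lborel. norm (G u * ?I n u) \<le> norm (G u) * B" for n
      by (intro AE_I2) (auto simp: norm_mult intro!: mult_left_mono I_le)
  qed (use G in auto)
  also have "(\<integral>u. G u * cnj (G u) \<partial>lborel) = of_real (\<integral>u. (cmod (G u))\<^sup>2 \<partial>lborel)"
    by (simp only: complex_norm_square[symmetric] integral_complex_of_real)
  finally have "(\<lambda>n. of_real (2 * pi) * (\<integral>u. G u * ?I n u \<partial>lborel))
      \<longlonglongrightarrow> of_real (2 * pi) * complex_of_real (\<integral>u. (cmod (G u))\<^sup>2 \<partial>lborel)"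
    by (intro tendsto_intros)
  moreover have "of_real (2 * pi) * (\<integral>u. G u * ?I n u \<partial>lborel)
      = complex_of_real (\<integral>x. exp (- ((\<eta> n * x)\<^sup>2) / 2) * (cmod (F x))\<^sup>2 \<partial>lborel)" for n
    using fourier_gaussian_parseval(1)[OF G \<eta>_pos[of n]]
    unfolding F_def integral_complex_of_real by (rule sym)
  ultimately have "(\<lambda>n. complex_of_real (\<integral>x. exp (- ((\<eta> n * x)\<^sup>2) / 2) * (cmod (F x))\<^sup>2 \<partial>lborel))
      \<longlonglongrightarrow> of_real (2 * pi * (\<integral>u. (cmod (G u))\<^sup>2 \<partial>lborel))"
    by (simp only: of_real_mult)
  then have lim: "(\<lambda>n. \<integral>x. exp (- ((\<eta> n * x)\<^sup>2) / 2) * (cmod (F x))\<^sup>2 \<partial>lborel)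
      \<longlonglongrightarrow> 2 * pi * (\<integral>u. (cmod (G u))\<^sup>2 \<partial>lborel)"
    by (simp only: tendsto_of_real_iff)
  have mono: "AE x in lborel. mono (\<lambda>n. exp (- ((\<eta> n * x)\<^sup>2) / 2) * (cmod (F x))\<^sup>2)"
  proof (intro AE_I2 monoI mult_right_mono)
    fix x :: real and n k :: nat assume "n \<le> k"
    then have "(\<eta> k)\<^sup>2 \<le> (\<eta> n)\<^sup>2" by (intro power_mono) (auto simp: \<eta>_def frac_le)
    then have "(\<eta> k)\<^sup>2 * x\<^sup>2 \<le> (\<eta> n)\<^sup>2 * x\<^sup>2" by (intro mult_right_mono) auto
    then show "exp (- ((\<eta> n * x)\<^sup>2) / 2) \<le> exp (- ((\<eta> k * x)\<^sup>2) / 2)"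
      by (simp add: power_mult_distrib)
  qed auto
  have pt: "AE x in lborel. (\<lambda>n. exp (- ((\<eta> n * x)\<^sup>2) / 2) * (cmod (F x))\<^sup>2) \<longlonglongrightarrow> (cmod (F x))\<^sup>2"
  proof (rule AE_I2)
    fix x
    have "(\<lambda>n. exp (- ((\<eta> n * x)\<^sup>2) / 2) * (cmod (F x))\<^sup>2) \<longlonglongrightarrow> exp (- ((0 * x)\<^sup>2) / 2) * (cmod (F x))\<^sup>2"
      by (intro tendsto_intros \<eta>_lim) simp
    then show "(\<lambda>n. exp (- ((\<eta> n * x)\<^sup>2) / 2) * (cmod (F x))\<^sup>2) \<longlonglongrightarrow> (cmod (F x))\<^sup>2" by simp
  qed
  have int: "integrable lborel (\<lambda>x. exp (- ((\<eta> n * x)\<^sup>2) / 2) * (cmod (F x))\<^sup>2)" for n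
    unfolding F_def by (rule fourier_gaussian_parseval(2)[OF G \<eta>_pos])
  note mc = int mono pt lim
  show ?int by (rule integrable_monotone_convergence[OF mc]) measurable
  show ?eq by (rule integral_monotone_convergence[OF mc]) measurable
qed

section \<open>Distance to band-limited functions\<close>

lemma cmod_diff_power2: "(cmod (a - b))\<^sup>2 = (cmod a)\<^sup>2 - 2 * Re (b * cnj a) + (cmod b)\<^sup>2"
  unfolding cmod_power2 by (simp add: power2_eq_square algebra_simps)

lemma norm_fourier_le:
  assumes "integrable lborel p"
  shows "cmod (fourier p u) \<le> (\<integral>x. cmod (p x) \<partial>lborel)"
  unfolding fourier_def by (rule order.trans[OF integral_norm_bound]) (simp add: norm_mult del: of_real_mult)

text \<open>Expand the square. Plancherel gives the energy of the band-limited function, and for the cross term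
  Fubini moves the inverse transform of \<open>g\<close> onto \<open>p\<close>, which turns \<open>p\<close> into its Fourier transform.\<close>

lemma integral_dist_fourier_inv_cutoff:
  fixes p g :: "real \<Rightarrow> complex" and m :: real
  defines "I \<equiv> {- pi * m..pi * m}"
  assumes p: "integrable lborel p" and p2: "integrable lborel (\<lambda>x. (cmod (p x))\<^sup>2)"
    and g: "continuous_on UNIV g"
  shows "integrable lborel (\<lambda>x. (cmod (fourier_inv_cutoff m g x - p x))\<^sup>2)" (is ?int)
    and "(\<integral>x. (cmod (fourier_inv_cutoff m g x - p x))\<^sup>2 \<partial>lborel)
      = (\<integral>x. (cmod (p x))\<^sup>2 \<partial>lborel)
        + (LBINT u:I. (cmod (g u))\<^sup>2 - 2 * Re (fourier p u * cnj (g u))) / (2 * pi)" (is ?eq)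
proof -
  define G where "G u = indicator I u *\<^sub>R g u" for u
  define F where "F x = (\<integral>u. iexp (- (u * x)) * G u \<partial>lborel)" for x
  have [measurable]: "p \<in> borel_measurable borel" using p by auto
  have g_sub: "continuous_on I g" using g continuous_on_subset by blast
  have G: "integrable lborel G"
    using borel_integrable_atLeastAtMost'[of "- pi * m" "pi * m" g] g_sub
    unfolding set_integrable_def G_def I_def by simp
  have [measurable]: "G \<in> borel_measurable borel" using G by auto
  have F_eq: "fourier_inv_cutoff m g x = of_real (1 / (2 * pi)) * F x" for x
    unfolding fourier_inv_cutoff_def F_def G_def I_def set_lebesgue_integral_def by (simp add: mult_ac)
  obtain B where B: "\<forall>u\<in>I. cmod (g u) \<le> B"
    using compact_imp_bounded[OF compact_continuous_image[OF g_sub]]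
    by (auto simp: bounded_iff I_def)
  have G_le: "cmod (G u) \<le> max B 0" for u
    using B by (auto simp: le_max_iff_disj G_def indicator_def)
  have cont: "AE u in lborel. isCont G u"
    using AE_lborel_singleton[of "- pi * m"] AE_lborel_singleton[of "pi * m"]
  proof eventually_elim
    case (elim u)
    then have "u \<notin> frontier I" by (auto simp: frontier_def I_def)
    then have "isCont (indicator I :: real \<Rightarrow> real) u" by (simp add: isCont_indicator)
    moreover have "isCont g u" using g by (simp add: continuous_on_eq_continuous_at)
    ultimately show ?case unfolding G_def[abs_def] by (intro continuous_intros)
  qed
  note pl = fourier_plancherel[OF G G_le cont, folded F_def]
  have G2: "(\<integral>u. (cmod (G u))\<^sup>2 \<partial>lborel) = (LBINT u:I. (cmod (g u))\<^sup>2)"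
    unfolding set_lebesgue_integral_def by (intro Bochner_Integration.integral_cong) (auto simp: G_def indicator_def)
  have [measurable]: "F \<in> borel_measurable borel" unfolding F_def by measurable
  have F_le: "norm (F x) \<le> (\<integral>u. norm (G u) \<partial>lborel)" for x
    unfolding F_def by (rule order.trans[OF integral_norm_bound]) (simp add: norm_mult del: of_real_mult of_real_minus)
  have pF: "integrable lborel (\<lambda>x. p x * cnj (F x))"
    by (rule Bochner_Integration.integrable_bound[where f="\<lambda>x. norm (p x) * (\<integral>u. norm (G u) \<partial>lborel)"])
       (use p F_le in \<open>auto simp: norm_mult intro!: mult_left_mono order.trans[OF _ abs_ge_self]\<close>)
  have cnjF: "cnj (F x) = (\<integral>v. iexp (v * x) * cnj (G v) \<partial>lborel)" for x
  proof -
    have "cnj (iexp (- (u * x)) * G u) = iexp (u * x) * cnj (G u)" for u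
      by (simp add: exp_cnj)
    then show ?thesis unfolding F_def by (simp only: flip: Bochner_Integration.integral_cnj)
  qed
  have cross: "(\<integral>x. p x * cnj (F x) \<partial>lborel) = (\<integral>u. cnj (G u) * fourier p u \<partial>lborel)"
    unfolding cnjF fourier_def
    by (rule Fubini_bounded_kernel[OF p]) (use G in \<open>auto simp del: of_real_mult\<close>)
  have fp[measurable]: "fourier p \<in> borel_measurable borel"
    unfolding fourier_def by measurable
  have Gp: "integrable lborel (\<lambda>u. cnj (G u) * fourier p u)"
    by (rule Bochner_Integration.integrable_bound[where f="\<lambda>u. norm (G u) * (\<integral>x. norm (p x) \<partial>lborel)"])
       (use G norm_fourier_le[OF p] in \<open>auto simp: norm_mult intro!: mult_left_mono order.trans[OF _ abs_ge_self]\<close>)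
  have Re_cross: "(\<integral>x. Re (p x * cnj (F x)) \<partial>lborel) = (LBINT u:I. Re (fourier p u * cnj (g u)))"
  proof -
    have "(\<integral>x. Re (p x * cnj (F x)) \<partial>lborel) = (\<integral>u. Re (cnj (G u) * fourier p u) \<partial>lborel)"
      by (simp only: integral_Re[OF pF] integral_Re[OF Gp] cross)
    also have "\<dots> = (LBINT u:I. Re (fourier p u * cnj (g u)))"
      unfolding set_lebesgue_integral_def
      by (intro Bochner_Integration.integral_cong) (auto simp: G_def indicator_def)
    finally show ?thesis .
  qed
  have expand: "(cmod (fourier_inv_cutoff m g x - p x))\<^sup>2
     = (1 / (2 * pi))\<^sup>2 * (cmod (F x))\<^sup>2 - 2 * (1 / (2 * pi)) * Re (p x * cnj (F x)) + (cmod (p x))\<^sup>2" for x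
  proof -
    have "Re (p x * cnj (of_real c * F x)) = c * Re (p x * cnj (F x))" for c
      by (simp add: algebra_simps)
    then show ?thesis
      unfolding F_eq cmod_diff_power2 norm_mult norm_of_real power_mult_distrib power2_abs
      by (simp only: mult.assoc)
  qed
  have Re_int: "integrable lborel (\<lambda>x. Re (p x * cnj (F x)))" using pF by (rule integrable_Re)
  show ?int unfolding expand using pl(1) Re_int p2 by simp
  have I1: "set_integrable lborel I (\<lambda>u. (cmod (g u))\<^sup>2)"
    unfolding I_def by (intro borel_integrable_atLeastAtMost' continuous_intros)
      (use g_sub in \<open>simp add: I_def\<close>)
  have I2: "set_integrable lborel I (\<lambda>u. Re (fourier p u * cnj (g u)))"
    unfolding set_integrable_def
    by (rule Bochner_Integration.integrable_cong[THEN iffD1, OF refl _ integrable_Re[OF Gp]])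
       (auto simp: G_def indicator_def mult_ac)
  have "(\<integral>x. (cmod (fourier_inv_cutoff m g x - p x))\<^sup>2 \<partial>lborel)
     = (1 / (2 * pi))\<^sup>2 * (2 * pi * (LBINT u:I. (cmod (g u))\<^sup>2))
       - 2 * (1 / (2 * pi)) * (LBINT u:I. Re (fourier p u * cnj (g u))) + (\<integral>x. (cmod (p x))\<^sup>2 \<partial>lborel)"
    unfolding expand using pl Re_int p2 by (simp add: Re_cross[simplified] G2)
  also have "\<dots> = (\<integral>x. (cmod (p x))\<^sup>2 \<partial>lborel)
       + ((LBINT u:I. (cmod (g u))\<^sup>2) - (LBINT u:I. 2 * Re (fourier p u * cnj (g u)))) / (2 * pi)"
  proof -
    have "(LBINT u:I. 2 * Re (fourier p u * cnj (g u))) = 2 * (LBINT u:I. Re (fourier p u * cnj (g u)))"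
      by (rule set_integral_mult_right)
    moreover have "(1 / (2 * pi))\<^sup>2 * (2 * pi * a) - 2 * (1 / (2 * pi)) * b + c = c + (a - 2 * b) / (2 * pi)" for a b c :: real
      by (simp add: field_simps power2_eq_square)
    ultimately show ?thesis by (simp only:)
  qed
  also have "(LBINT u:I. (cmod (g u))\<^sup>2) - (LBINT u:I. 2 * Re (fourier p u * cnj (g u)))
      = (LBINT u:I. (cmod (g u))\<^sup>2 - 2 * Re (fourier p u * cnj (g u)))"
    using I1 set_integrable_mult_right[OF I2, of 2] by (simp only: set_integral_diff(2))
  finally show ?eq .
qed

lemma continuous_on_fourier:
  assumes "integrable lborel p"
  shows "continuous_on UNIV (fourier p)"
  using continuous_on_integral_iexp[of lborel p] assms by (simp add: fourier_def[abs_def])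

text \<open>Pythagoras: \<open>fourier_inv_cutoff m (fourier p)\<close> is the orthogonal projection of \<open>p\<close> onto the functions with
  frequencies in the band, and the other term is the squared distance inside the band. The proof
  subtracts the expanded squares for \<open>g\<close> and for \<open>fourier p\<close>.\<close>

lemma L2_norm_sq_dist_fourier_inv_cutoff:
  fixes p g :: "real \<Rightarrow> complex" and m :: real
  assumes p: "integrable lborel p" and p2: "L2_norm_sq p < \<infinity>"
    and g: "continuous_on UNIV g"
  shows "L2_norm_sq (\<lambda>x. fourier_inv_cutoff m g x - p x)
    = L2_norm_sq (\<lambda>x. p x - fourier_inv_cutoff m (fourier p) x)
      + ennreal ((LBINT u:{- pi * m..pi * m}. (cmod (g u - fourier p u))\<^sup>2) / (2 * pi))"
proof -
  let ?I = "{- pi * m..pi * m}"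
  have [measurable]: "p \<in> borel_measurable borel" using p by auto
  have p2': "integrable lborel (\<lambda>x. (cmod (p x))\<^sup>2)"
    using p2 by (intro integrableI_nonneg) (auto simp: L2_norm_sq_def)
  have fp: "continuous_on UNIV (fourier p)" by (rule continuous_on_fourier[OF p])
  note G = integral_dist_fourier_inv_cutoff[OF p p2' g, of m]
  note P = integral_dist_fourier_inv_cutoff[OF p p2' fp, of m]
  have 1: "L2_norm_sq (\<lambda>x. fourier_inv_cutoff m g x - p x)
      = ennreal (\<integral>x. (cmod (fourier_inv_cutoff m g x - p x))\<^sup>2 \<partial>lborel)"
    unfolding L2_norm_sq_def by (rule nn_integral_eq_integral[OF G(1)]) simp
  have 2: "L2_norm_sq (\<lambda>x. p x - fourier_inv_cutoff m (fourier p) x)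
      = ennreal (\<integral>x. (cmod (fourier_inv_cutoff m (fourier p) x - p x))\<^sup>2 \<partial>lborel)"
    unfolding L2_norm_sq_def by (subst norm_minus_commute) (rule nn_integral_eq_integral[OF P(1)], simp)
  have c: "continuous_on ?I g" "continuous_on ?I (fourier p)"
    using g fp continuous_on_subset by blast+
  have ints: "set_integrable lborel ?I (\<lambda>u. (cmod (g u - fourier p u))\<^sup>2)"
    "set_integrable lborel ?I (\<lambda>u. (cmod (fourier p u))\<^sup>2 - 2 * Re (fourier p u * cnj (fourier p u)))"
    by (intro borel_integrable_atLeastAtMost' continuous_intros c)+
  have "(LBINT u:?I. (cmod (g u))\<^sup>2 - 2 * Re (fourier p u * cnj (g u)))
     = (LBINT u:?I. (cmod (fourier p u))\<^sup>2 - 2 * Re (fourier p u * cnj (fourier p u)))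
       + (LBINT u:?I. (cmod (g u - fourier p u))\<^sup>2)"
    by (subst set_integral_add(2)[symmetric, OF ints(2,1)])
       (simp add: cmod_diff_power2 complex_norm_square[symmetric] flip: of_real_power)
  then have 3: "(\<integral>x. (cmod (fourier_inv_cutoff m g x - p x))\<^sup>2 \<partial>lborel)
     = (\<integral>x. (cmod (fourier_inv_cutoff m (fourier p) x - p x))\<^sup>2 \<partial>lborel)
       + (LBINT u:?I. (cmod (g u - fourier p u))\<^sup>2) / (2 * pi)"
    unfolding G(2) P(2) by (simp add: field_simps)
  have "0 \<le> (LBINT u:?I. (cmod (g u - fourier p u))\<^sup>2)"
    unfolding set_lebesgue_integral_def by (intro Bochner_Integration.integral_nonneg) auto
  then show ?thesis unfolding 1 2 3 by (intro ennreal_plus) auto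
qed

section \<open>Mean square error of sample means\<close>

text \<open>The decomposition of a mean square error into variance and squared bias: the centred summands are
  orthogonal, so their mixed products have expectation zero, and the variance of one summand is at
  most its second moment.\<close>

lemma (in prob_space) mean_square_error_sample_mean:
  fixes X :: "nat \<Rightarrow> 'a \<Rightarrow> complex" and c \<mu> :: complex
  assumes ind: "indep_vars (\<lambda>_. borel) X {..<n}"
    and sq: "\<And>i. i < n \<Longrightarrow> integrable M (\<lambda>\<omega>. (cmod (X i \<omega>))\<^sup>2)"
    and mean: "\<And>i. i < n \<Longrightarrow> expectation (X i) = \<mu>"
    and s: "\<And>i. i < n \<Longrightarrow> expectation (\<lambda>\<omega>. (cmod (X i \<omega>))\<^sup>2) \<le> s"
    and n: "n \<ge> 1"
  shows "integrable M (\<lambda>\<omega>. (cmod (1 / of_nat n * (\<Sum>i<n. X i \<omega>) - c))\<^sup>2)" (is ?int)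
    and "expectation (\<lambda>\<omega>. (cmod (1 / of_nat n * (\<Sum>i<n. X i \<omega>) - c))\<^sup>2) \<le> s / real n + (cmod (\<mu> - c))\<^sup>2" (is ?le)
proof -
  have Xm: "X i \<in> borel_measurable M" if "i < n" for i
    using ind that by (auto simp: indep_vars_def)
  have X1: "integrable M (X i)" if "i < n" for i
  proof (rule Bochner_Integration.integrable_bound)
    show "integrable M (\<lambda>\<omega>. 1 + (cmod (X i \<omega>))\<^sup>2)" using sq[OF that] by simp
    have "cmod z \<le> 1 + (cmod z)\<^sup>2" for z
    proof -
      have "0 \<le> (cmod z - 1)\<^sup>2 + cmod z" by simp
      then show ?thesis by (simp add: power2_eq_square algebra_simps)
    qed
    then show "AE \<omega> in M. norm (X i \<omega>) \<le> norm (1 + (cmod (X i \<omega>))\<^sup>2)"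
      by (intro AE_I2) (auto intro: order.trans[OF _ abs_ge_self])
  qed (rule Xm[OF that])
  have affine: "expectation (\<lambda>\<omega>. f \<omega> - 2 * r \<omega> + k) = expectation f - 2 * expectation r + k"
    if "integrable M f" "integrable M r" for f r :: "'a \<Rightarrow> real" and k
    using that by (simp add: prob_space)
  define Y where "Y i \<omega> = X i \<omega> - \<mu>" for i \<omega>
  have Y1: "integrable M (Y i)" if "i < n" for i using X1[OF that] by (simp add: Y_def[abs_def])
  have Y0: "expectation (Y i) = 0" if "i < n" for i
    using X1[OF that] mean[OF that] by (simp add: Y_def[abs_def] prob_space)
  have Y2eq: "(cmod (Y i \<omega>))\<^sup>2 = (cmod (X i \<omega>))\<^sup>2 - 2 * Re (\<mu> * cnj (X i \<omega>)) + (cmod \<mu>)\<^sup>2" for i \<omega>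
    unfolding Y_def by (rule cmod_diff_power2)
  have muX: "integrable M (\<lambda>\<omega>. Re (\<mu> * cnj (X i \<omega>)))" if "i < n" for i
    using X1[OF that] by (intro integrable_Re integrable_mult_right) auto
  have Y2: "integrable M (\<lambda>\<omega>. (cmod (Y i \<omega>))\<^sup>2)" if "i < n" for i
    unfolding Y2eq using sq[OF that] muX[OF that]
    by (intro Bochner_Integration.integrable_add Bochner_Integration.integrable_diff integrable_mult_right) auto
  have Y2s: "expectation (\<lambda>\<omega>. (cmod (Y i \<omega>))\<^sup>2) \<le> s" if "i < n" for i
  proof -
    have "expectation (\<lambda>\<omega>. Re (\<mu> * cnj (X i \<omega>))) = Re (\<mu> * cnj (expectation (X i)))"
      using X1[OF that] by (subst integral_Re) auto
    then have "expectation (\<lambda>\<omega>. (cmod (Y i \<omega>))\<^sup>2) = expectation (\<lambda>\<omega>. (cmod (X i \<omega>))\<^sup>2) - 2 * Re (\<mu> * cnj \<mu>) + (cmod \<mu>)\<^sup>2"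
      unfolding Y2eq affine[OF sq[OF that] muX[OF that]] using mean[OF that] by (simp only:)
    also have "Re (\<mu> * cnj \<mu>) = (cmod \<mu>)\<^sup>2" by (simp add: complex_norm_square[symmetric] flip: of_real_power)
    finally show ?thesis using s[OF that] zero_le_power2[of "cmod \<mu>"] by linarith
  qed
  have prod: "integrable M (\<lambda>\<omega>. Y i \<omega> * cnj (Y j \<omega>)) \<and>
      expectation (\<lambda>\<omega>. Y i \<omega> * cnj (Y j \<omega>)) = (if i = j then of_real (expectation (\<lambda>\<omega>. (cmod (Y i \<omega>))\<^sup>2)) else 0)"
    if "i < n" "j < n" for i j
  proof (cases "i = j")
    case True
    then show ?thesis using Y2[OF that(1)]
      by (simp add: complex_norm_square[symmetric] flip: of_real_power)
  next
    case False
    \<comment> \<open>The conjugation is absorbed in one member of the independent family, so that the expectation of the product factorises.\<close>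
    define W where "W k \<omega> = (if k = i then Y k \<omega> else cnj (Y k \<omega>))" for k \<omega>
    have W: "indep_vars (\<lambda>_. borel) W {i, j}"
    proof -
      have "indep_vars (\<lambda>_. borel) (\<lambda>k \<omega>. (\<lambda>z. if k = i then z - \<mu> else cnj (z - \<mu>)) (X k \<omega>)) {i, j}"
        by (rule indep_vars_compose2[OF indep_vars_subset[OF ind]]) (use that in auto)
      then show ?thesis unfolding W_def[abs_def] Y_def .
    qed
    have "integrable M (W k)" if "k \<in> {i, j}" for k
      using Y1 \<open>i < n\<close> \<open>j < n\<close> that by (cases "k = i") (auto simp: W_def[abs_def])
    note indep_vars_lebesgue_integral[OF _ W this] indep_vars_integrable[OF _ W this]
    moreover have "(\<Prod>k\<in>{i, j}. W k \<omega>) = Y i \<omega> * cnj (Y j \<omega>)" for \<omega>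
      using False by (simp add: W_def)
    moreover have "expectation (W i) = 0" using Y0[OF that(1)] by (simp add: W_def[abs_def])
    ultimately show ?thesis using False by simp
  qed
  define A where "A \<omega> = 1 / of_nat n * (\<Sum>i<n. Y i \<omega>)" for \<omega>
  have A1: "integrable M A" unfolding A_def[abs_def] using Y1 by (intro integrable_mult_right) auto
  have A0: "expectation A = 0" unfolding A_def[abs_def] using Y1 Y0 by simp
  have A2eq: "complex_of_real ((cmod (A \<omega>))\<^sup>2) = of_real (1 / (real n)\<^sup>2) * (\<Sum>i<n. \<Sum>j<n. Y i \<omega> * cnj (Y j \<omega>))" for \<omega>
    unfolding complex_norm_square A_def by (simp add: sum_product power2_eq_square)
  have dsum: "integrable M (\<lambda>\<omega>. \<Sum>i<n. \<Sum>j<n. Y i \<omega> * cnj (Y j \<omega>))"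
    using prod by (intro Bochner_Integration.integrable_sum) auto
  have A2c: "integrable M (\<lambda>\<omega>. complex_of_real ((cmod (A \<omega>))\<^sup>2))"
    unfolding A2eq using dsum by (intro integrable_mult_right)
  have A2: "integrable M (\<lambda>\<omega>. (cmod (A \<omega>))\<^sup>2)" using integrable_Re[OF A2c] by simp
  have "complex_of_real (expectation (\<lambda>\<omega>. (cmod (A \<omega>))\<^sup>2)) = expectation (\<lambda>\<omega>. complex_of_real ((cmod (A \<omega>))\<^sup>2))"
    by (rule integral_complex_of_real[symmetric])
  also have "\<dots> = of_real (1 / (real n)\<^sup>2) * (\<Sum>i<n. \<Sum>j<n. expectation (\<lambda>\<omega>. Y i \<omega> * cnj (Y j \<omega>)))"
  proof -
    have "expectation (\<lambda>\<omega>. \<Sum>i<n. \<Sum>j<n. Y i \<omega> * cnj (Y j \<omega>)) = (\<Sum>i<n. expectation (\<lambda>\<omega>. \<Sum>j<n. Y i \<omega> * cnj (Y j \<omega>)))"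
      by (rule Bochner_Integration.integral_sum) (use prod in auto)
    also have "\<dots> = (\<Sum>i<n. \<Sum>j<n. expectation (\<lambda>\<omega>. Y i \<omega> * cnj (Y j \<omega>)))"
      by (intro sum.cong refl Bochner_Integration.integral_sum) (use prod in auto)
    finally show ?thesis unfolding A2eq integral_mult_right_zero by (simp only:)
  qed
  also have "(\<Sum>i<n. \<Sum>j<n. expectation (\<lambda>\<omega>. Y i \<omega> * cnj (Y j \<omega>))) = (\<Sum>i<n. of_real (expectation (\<lambda>\<omega>. (cmod (Y i \<omega>))\<^sup>2)))"
  proof (intro sum.cong refl)
    fix i assume "i \<in> {..<n}"
    then have i: "i < n" by simp
    have "(\<Sum>j<n. expectation (\<lambda>\<omega>. Y i \<omega> * cnj (Y j \<omega>)))
        = (\<Sum>j<n. if i = j then complex_of_real (expectation (\<lambda>\<omega>. (cmod (Y i \<omega>))\<^sup>2)) else 0)"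
      by (intro sum.cong refl) (use prod[OF i] in simp)
    also have "\<dots> = of_real (expectation (\<lambda>\<omega>. (cmod (Y i \<omega>))\<^sup>2))"
      using i by simp
    finally show "(\<Sum>j<n. expectation (\<lambda>\<omega>. Y i \<omega> * cnj (Y j \<omega>))) = of_real (expectation (\<lambda>\<omega>. (cmod (Y i \<omega>))\<^sup>2))" .
  qed
  finally have "expectation (\<lambda>\<omega>. (cmod (A \<omega>))\<^sup>2) = 1 / (real n)\<^sup>2 * (\<Sum>i<n. expectation (\<lambda>\<omega>. (cmod (Y i \<omega>))\<^sup>2))"
    by (simp only: of_real_sum[symmetric] of_real_mult[symmetric] of_real_eq_iff)
  also have "\<dots> \<le> 1 / (real n)\<^sup>2 * (\<Sum>i<n. s)"
    by (intro mult_left_mono sum_mono Y2s) auto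
  also have "\<dots> = s / real n" using n by (simp add: power2_eq_square)
  finally have A2s: "expectation (\<lambda>\<omega>. (cmod (A \<omega>))\<^sup>2) \<le> s / real n" .
  have expand: "(cmod (1 / of_nat n * (\<Sum>i<n. X i \<omega>) - c))\<^sup>2
      = (cmod (A \<omega>))\<^sup>2 - 2 * Re ((c - \<mu>) * cnj (A \<omega>)) + (cmod (c - \<mu>))\<^sup>2" for \<omega>
  proof -
    have "1 / of_nat n * (\<Sum>i<n. X i \<omega>) - c = A \<omega> - (c - \<mu>)"
      using n unfolding A_def Y_def by (simp add: sum_subtractf field_simps)
    then show ?thesis by (simp only: cmod_diff_power2)
  qed
  have muA: "integrable M (\<lambda>\<omega>. (c - \<mu>) * cnj (A \<omega>))"
    using A1 by (intro integrable_mult_right) auto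
  have "expectation (\<lambda>\<omega>. Re ((c - \<mu>) * cnj (A \<omega>))) = 0"
    using A0 by (subst integral_Re[OF muA]) simp
  then show ?le
    unfolding expand affine[OF A2 integrable_Re[OF muA]] using A2s by (simp add: norm_minus_commute)
  show ?int
    unfolding expand using A2 integrable_Re[OF muA]
    by (intro Bochner_Integration.integrable_add Bochner_Integration.integrable_diff integrable_mult_right) auto
qed

section \<open>Levy exponents and marginals\<close>

definition levy_exponent_deriv :: "real \<Rightarrow> real \<Rightarrow> (real \<Rightarrow> real) \<Rightarrow> real \<Rightarrow> complex" where
  "levy_exponent_deriv b \<sigma> \<nu> u =
     \<i> * of_real b - of_real (u * \<sigma>\<^sup>2)
     + (\<integral>x. \<i> * of_real x * (iexp (u * x) - 1) * of_real (\<nu> x) \<partial>lborel)"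

definition levy_exponent_deriv2 :: "real \<Rightarrow> (real \<Rightarrow> real) \<Rightarrow> real \<Rightarrow> complex" where
  "levy_exponent_deriv2 \<sigma> \<nu> u =
     - of_real (\<sigma>\<^sup>2) + (\<integral>x. iexp (u * x) * ((\<i> * of_real x)\<^sup>2 * of_real (\<nu> x)) \<partial>lborel)"

text \<open>The variance of the process at time \<open>1\<close>. It bounds the second derivative of the exponent, hence also
  the slope of the first derivative.\<close>

definition levy_curvature :: "real \<Rightarrow> (real \<Rightarrow> real) \<Rightarrow> real" where
  "levy_curvature \<sigma> \<nu> = \<sigma>\<^sup>2 + (\<integral>x. x\<^sup>2 * \<nu> x \<partial>lborel)"

lemma abs_power_le_interpolate:
  fixes x :: real
  assumes "i \<le> j" "j \<le> k"
  shows "\<bar>x\<bar> ^ j \<le> \<bar>x\<bar> ^ i + \<bar>x\<bar> ^ k"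
proof (cases "\<bar>x\<bar> \<le> 1")
  case True
  then have "\<bar>x\<bar> ^ j \<le> \<bar>x\<bar> ^ i" using assms by (intro power_decreasing) auto
  then show ?thesis by (simp add: add_increasing2)
next
  case False
  then have "\<bar>x\<bar> ^ j \<le> \<bar>x\<bar> ^ k" using assms by (intro power_increasing) auto
  then show ?thesis by (simp add: add_increasing)
qed

context
  fixes \<nu> :: "real \<Rightarrow> real"
  assumes nu_meas [measurable]: "\<nu> \<in> borel_measurable borel"
    and nu_nonneg: "\<And>x. 0 \<le> \<nu> x"
    and moment2: "integrable lborel (\<lambda>x. x ^ 2 * \<nu> x)"
begin

lemma levy_curvature_nonneg: "0 \<le> levy_curvature \<sigma> \<nu>"
  unfolding levy_curvature_def using nu_nonneg by (intro add_nonneg_nonneg Bochner_Integration.integral_nonneg) auto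

lemma norm_compensated_le: "cmod (\<i> * of_real x * (iexp (u * x) - 1) * of_real (\<nu> x)) \<le> \<bar>u\<bar> * (x\<^sup>2 * \<nu> x)"
proof -
  have "cmod (iexp (u * x) - 1) \<le> \<bar>u * x\<bar>" using iexp_approx1[of "u * x" 0] by simp
  then have "\<bar>x\<bar> * cmod (iexp (u * x) - 1) * \<nu> x \<le> \<bar>x\<bar> * \<bar>u * x\<bar> * \<nu> x"
    using nu_nonneg by (intro mult_left_mono mult_right_mono) auto
  also have "\<bar>x\<bar> * \<bar>u * x\<bar> * \<nu> x = \<bar>u\<bar> * (x\<^sup>2 * \<nu> x)"
    by (simp add: abs_mult power2_eq_square)
  finally show ?thesis using nu_nonneg by (simp add: norm_mult)
qed

lemma integrable_compensated: "integrable lborel (\<lambda>x. \<i> * of_real x * (iexp (u * x) - 1) * of_real (\<nu> x))"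
  by (rule Bochner_Integration.integrable_bound[OF integrable_mult_right[OF moment2, of "\<bar>u\<bar>"]])
     (use norm_compensated_le[of _ u] in \<open>auto intro!: AE_I2 order.trans[OF _ abs_ge_self] simp del: of_real_mult\<close>)

lemma has_vector_derivative_levy_exponent:
  "(levy_exponent b \<sigma> \<nu> has_vector_derivative levy_exponent_deriv b \<sigma> \<nu> u) (at u)"
proof -
  have jump: "((\<lambda>u. \<integral>x. (iexp (u * x) - 1 - \<i> * of_real (u * x)) * of_real (\<nu> x) \<partial>lborel)
      has_vector_derivative (\<integral>x. \<i> * of_real x * (iexp (u * x) - 1) * of_real (\<nu> x) \<partial>lborel)) (at u)"
  proof (rule has_vector_derivative_integral[where w="\<lambda>x. (\<bar>u\<bar> + 1) * (x\<^sup>2 * \<nu> x)"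
        and f="\<lambda>u x. (iexp (u * x) - 1 - \<i> * of_real (u * x)) * of_real (\<nu> x)"
        and f'="\<lambda>u x. \<i> * of_real x * (iexp (u * x) - 1) * of_real (\<nu> x)"])
    fix v :: real
    show "integrable lborel (\<lambda>x. (iexp (v * x) - 1 - \<i> * of_real (v * x)) * of_real (\<nu> x))"
    proof (rule Bochner_Integration.integrable_bound[OF integrable_mult_right[OF moment2, of "v\<^sup>2"]])
      have "cmod ((iexp (v * x) - 1 - \<i> * of_real (v * x)) * of_real (\<nu> x)) \<le> v\<^sup>2 * (x ^ 2 * \<nu> x)" for x
      proof -
        have "cmod (iexp (v * x) - 1 - \<i> * of_real (v * x)) \<le> \<bar>v * x\<bar> ^ 2 / 2"
          using iexp_approx1[of "v * x" 1] by (simp add: algebra_simps numeral_2_eq_2)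
        also have "\<dots> \<le> v\<^sup>2 * x\<^sup>2" by (simp add: power_mult_distrib)
        finally have "cmod (iexp (v * x) - 1 - \<i> * of_real (v * x)) * \<nu> x \<le> v\<^sup>2 * x\<^sup>2 * \<nu> x"
          using nu_nonneg by (rule mult_right_mono)
        then show ?thesis using nu_nonneg by (simp add: norm_mult mult.assoc)
      qed
      then show "AE x in lborel. cmod ((iexp (v * x) - 1 - \<i> * of_real (v * x)) * of_real (\<nu> x)) \<le> norm (v\<^sup>2 * (x ^ 2 * \<nu> x))"
        by (intro AE_I2) (metis abs_ge_self order.trans real_norm_def)
    qed simp
    fix x
    have lin: "((\<lambda>u. \<i> * of_real (u * x)) has_vector_derivative \<i> * of_real x) (at v)"
      by (auto intro!: derivative_eq_intros simp: has_vector_derivative_of_real)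
    have "((\<lambda>u. (iexp (u * x) - 1 - \<i> * of_real (u * x)) * of_real (\<nu> x)) has_vector_derivative
        (\<i> * of_real x * iexp (v * x) - 0 - \<i> * of_real x) * of_real (\<nu> x)) (at v)"
      by (intro has_vector_derivative_mult_left has_vector_derivative_diff has_vector_derivative_const
          has_vector_derivative_iexp_scaled lin)
    then show "((\<lambda>u. (iexp (u * x) - 1 - \<i> * of_real (u * x)) * of_real (\<nu> x)) has_vector_derivative
        \<i> * of_real x * (iexp (v * x) - 1) * of_real (\<nu> x)) (at v)"
      by (simp add: right_diff_distrib)
    assume "\<bar>v - u\<bar> \<le> 1"
    then have "\<bar>v\<bar> \<le> \<bar>u\<bar> + 1" by linarith
    then show "cmod (\<i> * of_real x * (iexp (v * x) - 1) * of_real (\<nu> x)) \<le> (\<bar>u\<bar> + 1) * (x\<^sup>2 * \<nu> x)"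
      using nu_nonneg by (intro order.trans[OF norm_compensated_le] mult_right_mono) auto
  qed (use moment2 in auto)
  have drift: "((\<lambda>u. \<i> * of_real (u * b) - of_real (u\<^sup>2 * \<sigma>\<^sup>2 / 2)) has_vector_derivative
      \<i> * of_real b - of_real (u * \<sigma>\<^sup>2)) (at u)"
    by (intro has_vector_derivative_diff has_vector_derivative_mult_right has_vector_derivative_of_real)
       (auto intro!: derivative_eq_intros)
  show ?thesis
    unfolding levy_exponent_def[abs_def] levy_exponent_deriv_def
    by (intro has_vector_derivative_add drift jump)
qed

lemma integrable_quadratic_jump: "integrable lborel (\<lambda>x. (\<i> * of_real x)\<^sup>2 * complex_of_real (\<nu> x))"
  by (rule Bochner_Integration.integrable_bound[OF moment2])
     (auto simp: norm_mult norm_power)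

lemma has_vector_derivative_levy_exponent_deriv:
  "(levy_exponent_deriv b \<sigma> \<nu> has_vector_derivative levy_exponent_deriv2 \<sigma> \<nu> u) (at u)"
proof -
  have jump: "((\<lambda>u. \<integral>x. \<i> * of_real x * (iexp (u * x) - 1) * of_real (\<nu> x) \<partial>lborel)
      has_vector_derivative (\<integral>x. iexp (u * x) * ((\<i> * of_real x)\<^sup>2 * of_real (\<nu> x)) \<partial>lborel)) (at u)"
  proof (rule has_vector_derivative_integral[where w="\<lambda>x. x\<^sup>2 * \<nu> x"
        and f="\<lambda>u x. \<i> * of_real x * (iexp (u * x) - 1) * of_real (\<nu> x)"
        and f'="\<lambda>u x. iexp (u * x) * ((\<i> * of_real x)\<^sup>2 * of_real (\<nu> x))"])
    fix v x :: real
    have "((\<lambda>u. \<i> * of_real x * (iexp (u * x) - 1) * of_real (\<nu> x)) has_vector_derivative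
        \<i> * of_real x * (\<i> * of_real x * iexp (v * x) - 0) * of_real (\<nu> x)) (at v)"
      by (intro has_vector_derivative_mult_left has_vector_derivative_mult_right has_vector_derivative_diff
          has_vector_derivative_const has_vector_derivative_iexp_scaled)
    then show "((\<lambda>u. \<i> * of_real x * (iexp (u * x) - 1) * of_real (\<nu> x)) has_vector_derivative
        iexp (v * x) * ((\<i> * of_real x)\<^sup>2 * of_real (\<nu> x))) (at v)"
      by (simp add: power2_eq_square mult_ac)
    show "cmod (iexp (v * x) * ((\<i> * of_real x)\<^sup>2 * of_real (\<nu> x))) \<le> x\<^sup>2 * \<nu> x"
      using nu_nonneg by (simp add: norm_mult norm_power del: of_real_mult)
  qed (use moment2 integrable_compensated in auto)
  have drift: "((\<lambda>u. \<i> * of_real b - of_real (u * \<sigma>\<^sup>2)) has_vector_derivative - complex_of_real (\<sigma>\<^sup>2)) (at u)"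
  proof -
    have "((\<lambda>u. \<i> * of_real b - of_real (u * \<sigma>\<^sup>2)) has_vector_derivative 0 - complex_of_real (\<sigma>\<^sup>2)) (at u)"
      by (intro has_vector_derivative_diff has_vector_derivative_const has_vector_derivative_of_real)
         (auto intro!: derivative_eq_intros)
    then show ?thesis by simp
  qed
  show ?thesis
    unfolding levy_exponent_deriv_def[abs_def] levy_exponent_deriv2_def
    by (intro has_vector_derivative_add drift jump)
qed

lemma norm_levy_exponent_deriv2_le: "cmod (levy_exponent_deriv2 \<sigma> \<nu> u) \<le> levy_curvature \<sigma> \<nu>"
proof -
  have "cmod (\<integral>x. iexp (u * x) * ((\<i> * of_real x)\<^sup>2 * of_real (\<nu> x)) \<partial>lborel) \<le> (\<integral>x. x\<^sup>2 * \<nu> x \<partial>lborel)"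
    by (rule order.trans[OF integral_norm_bound])
       (use nu_nonneg in \<open>simp add: norm_mult norm_power del: of_real_mult\<close>)
  then show ?thesis unfolding levy_exponent_deriv2_def levy_curvature_def
    by (intro order.trans[OF norm_triangle_ineq] add_mono) (auto simp: norm_power)
qed

lemma norm_levy_exponent_deriv_le:
  "cmod (levy_exponent_deriv b \<sigma> \<nu> u) \<le> \<bar>b\<bar> + levy_curvature \<sigma> \<nu> * \<bar>u\<bar>"
proof -
  have "cmod (\<integral>x. \<i> * of_real x * (iexp (u * x) - 1) * of_real (\<nu> x) \<partial>lborel) \<le> (\<integral>x. \<bar>u\<bar> * (x\<^sup>2 * \<nu> x) \<partial>lborel)"
    by (rule Bochner_Integration.integral_norm_bound_integral)
       (use integrable_compensated moment2 norm_compensated_le in auto)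
  then have jump: "cmod (\<integral>x. \<i> * of_real x * (iexp (u * x) - 1) * of_real (\<nu> x) \<partial>lborel) \<le> \<bar>u\<bar> * (\<integral>x. x\<^sup>2 * \<nu> x \<partial>lborel)"
    by simp
  have "cmod (\<i> * of_real b - of_real (u * \<sigma>\<^sup>2)) \<le> cmod (\<i> * of_real b) + cmod (of_real (u * \<sigma>\<^sup>2))"
    by (rule norm_triangle_ineq4)
  also have "\<dots> = \<bar>b\<bar> + \<bar>u\<bar> * \<sigma>\<^sup>2" by (simp only: norm_mult norm_of_real) (simp add: abs_mult)
  finally show ?thesis unfolding levy_exponent_deriv_def levy_curvature_def
    using jump norm_triangle_ineq[of "\<i> * of_real b - of_real (u * \<sigma>\<^sup>2)" "\<integral>x. \<i> * of_real x * (iexp (u * x) - 1) * of_real (\<nu> x) \<partial>lborel"]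
    by (simp add: algebra_simps)
qed

context
  assumes moment6: "integrable lborel (\<lambda>x. x ^ 6 * \<nu> x)"
begin

lemma integrable_levy_moment:
  assumes "2 \<le> k" "k \<le> 6"
  shows "integrable lborel (\<lambda>x. x ^ k * \<nu> x)"
proof (rule Bochner_Integration.integrable_bound[OF Bochner_Integration.integrable_add[OF moment2 moment6]])
  show "AE x in lborel. norm (x ^ k * \<nu> x) \<le> norm (x ^ 2 * \<nu> x + x ^ 6 * \<nu> x)"
  proof (rule AE_I2)
    fix x :: real
    have "\<bar>x\<bar> ^ k * \<nu> x \<le> (\<bar>x\<bar> ^ 2 + \<bar>x\<bar> ^ 6) * \<nu> x"
      using assms nu_nonneg by (intro mult_right_mono abs_power_le_interpolate) auto
    then show "norm (x ^ k * \<nu> x) \<le> norm (x ^ 2 * \<nu> x + x ^ 6 * \<nu> x)"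
      using nu_nonneg by (simp add: abs_mult power_abs distrib_right)
  qed
qed simp

lemma integrable_levy_moment_complex:
  assumes "2 \<le> k" "k \<le> 6"
  shows "integrable lborel (\<lambda>x. (\<i> * of_real x) ^ k * complex_of_real (\<nu> x))"
  by (rule Bochner_Integration.integrable_bound[OF integrable_levy_moment[OF assms]])
     (auto simp: norm_mult norm_power abs_mult power_abs)

lemma has_vector_derivative_levy_exponent_deriv2:
  "(levy_exponent_deriv2 \<sigma> \<nu> has_vector_derivative
      (\<integral>x. iexp (u * x) * ((\<i> * of_real x) ^ 3 * of_real (\<nu> x)) \<partial>lborel)) (at u)"
proof -
  have eq: "\<i> * of_real x * ((\<i> * of_real x)\<^sup>2 * of_real (\<nu> x)) = (\<i> * of_real x) ^ 3 * of_real (\<nu> x)" for x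
    by (simp add: power2_eq_square power3_eq_cube)
  have "((\<lambda>u. \<integral>x. iexp (u * x) * ((\<i> * of_real x)\<^sup>2 * of_real (\<nu> x)) \<partial>lborel) has_vector_derivative
      (\<integral>x. iexp (u * x) * (\<i> * of_real x * ((\<i> * of_real x)\<^sup>2 * of_real (\<nu> x))) \<partial>lborel)) (at u)"
    by (rule has_vector_derivative_integral_iexp)
       (use integrable_quadratic_jump integrable_levy_moment_complex[of 3] in \<open>auto simp only: eq sets_lborel\<close>)
  from has_vector_derivative_add[OF has_vector_derivative_const[of "- complex_of_real (\<sigma>\<^sup>2)"] this]
  show ?thesis unfolding levy_exponent_deriv2_def[abs_def] eq by simp
qed

lemma Ck_levy_exponent_deriv: "Ck 5 (levy_exponent_deriv b \<sigma> \<nu>)"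
proof -
  have "Ck 4 (\<lambda>u. \<integral>x. iexp (u * x) * ((\<i> * of_real x)\<^sup>2 * of_real (\<nu> x)) \<partial>lborel)"
  proof (rule Ck_integral_iexp)
    fix j :: nat assume "j \<le> 4"
    then show "integrable lborel (\<lambda>x. (\<i> * of_real x) ^ j * ((\<i> * of_real x)\<^sup>2 * complex_of_real (\<nu> x)))"
      using integrable_levy_moment_complex[of "j + 2"] by (simp only: power_add mult.assoc)
  qed simp
  then have "Ck 4 (levy_exponent_deriv2 \<sigma> \<nu>)"
    unfolding levy_exponent_deriv2_def[abs_def] by (intro Ck_add Ck_const)
  from Ck_SucI[OF has_vector_derivative_levy_exponent_deriv this] show ?thesis by simp
qed

lemma has_vector_derivative_exp_levy:
  "((\<lambda>u. exp (of_real t * levy_exponent b \<sigma> \<nu> u)) has_vector_derivative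
     of_real t * levy_exponent_deriv b \<sigma> \<nu> u * exp (of_real t * levy_exponent b \<sigma> \<nu> u)) (at u)"
proof -
  have "((\<lambda>u. of_real t * levy_exponent b \<sigma> \<nu> u) has_vector_derivative of_real t * levy_exponent_deriv b \<sigma> \<nu> u) (at u)"
    by (intro has_vector_derivative_mult_right has_vector_derivative_levy_exponent)
  from field_vector_diff_chain_at[OF this DERIV_exp] show ?thesis by (simp add: comp_def)
qed

text \<open>The moment has to be proved, since only the characteristic function of the marginal is given. The
  moments of \<open>\<nu>\<close> make the exponent six times differentiable, and this smoothness passes to the
  characteristic function and from there to the moments of \<open>\<mu>\<close>.\<close>

lemma sixth_moment_levy_marginal:
  assumes "real_distribution \<mu>" and char: "\<And>u. char \<mu> u = exp (of_real t * levy_exponent b \<sigma> \<nu> u)"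
  shows "integrable \<mu> (\<lambda>x. x ^ 6)"
proof -
  interpret real_distribution \<mu> by fact
  have char': "char \<mu> = (\<lambda>u. exp (of_real t * levy_exponent b \<sigma> \<nu> u))" using char by auto
  have "Ck (Suc 5) (char \<mu>)"
    unfolding char'
    by (rule Ck_linear_ode[where a="\<lambda>u. of_real t * levy_exponent_deriv b \<sigma> \<nu> u"])
       (intro has_vector_derivative_exp_levy Ck_mult Ck_const Ck_levy_exponent_deriv)+
  then have "Ck (2 * 3) (char \<mu>)" by simp
  from Ck_char_imp_moment[OF this] show ?thesis by simp
qed

text \<open>Both sides are the third derivative of \<open>char \<mu> = exp (t * \<psi>)\<close>: the left one taken under the
  integral, the right one by the chain and product rules, with \<open>\<psi>'''\<close> written as an integral against
  \<open>\<nu>\<close>.\<close>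

lemma third_derivative_levy_marginal:
  assumes "real_distribution \<mu>" and char: "\<And>u. char \<mu> u = exp (of_real t * levy_exponent b \<sigma> \<nu> u)"
  shows "(\<integral>x. iexp (u * x) * (\<i> * of_real x) ^ 3 \<partial>\<mu>)
    = (of_real t * (\<integral>x. iexp (u * x) * ((\<i> * of_real x) ^ 3 * of_real (\<nu> x)) \<partial>lborel)
       + 3 * of_real t ^ 2 * levy_exponent_deriv b \<sigma> \<nu> u * levy_exponent_deriv2 \<sigma> \<nu> u
       + of_real t ^ 3 * levy_exponent_deriv b \<sigma> \<nu> u ^ 3) * char \<mu> u"
proof -
  interpret real_distribution \<mu> by fact
  have mom: "integrable \<mu> (\<lambda>x. (\<i> * of_real x) ^ k)" if "k \<le> 6" for k
  proof (rule Bochner_Integration.integrable_bound[where f="\<lambda>x. 1 + x ^ 6"])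
    show "integrable \<mu> (\<lambda>x. 1 + x ^ 6)" using sixth_moment_levy_marginal[OF assms] by simp
    show "AE x in \<mu>. cmod ((\<i> * of_real x) ^ k) \<le> norm (1 + x ^ 6)"
    proof (rule AE_I2)
      fix x :: real
      show "cmod ((\<i> * of_real x) ^ k) \<le> norm (1 + x ^ 6)"
        using abs_power_le_interpolate[of 0 k 6 x] that by (simp add: norm_mult norm_power)
    qed
  qed simp
  let ?\<phi> = "char \<mu>" and ?a = "levy_exponent_deriv b \<sigma> \<nu>" and ?a' = "levy_exponent_deriv2 \<sigma> \<nu>"
    and ?a'' = "\<lambda>u. \<integral>x. iexp (u * x) * ((\<i> * of_real x) ^ 3 * of_real (\<nu> x)) \<partial>lborel"
    and ?m = "\<lambda>k u. \<integral>x. iexp (u * x) * (\<i> * of_real x) ^ k \<partial>\<mu>"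
  have m_der: "(?m k has_vector_derivative ?m (Suc k) u) (at u)" if "k \<le> 5" for k u
    using has_vector_derivative_integral_iexp[of \<mu> "\<lambda>x. (\<i> * of_real x) ^ k" u] mom[of k] mom[of "Suc k"] that
    by (simp del: of_real_mult)
  have \<phi>_der: "(?\<phi> has_vector_derivative of_real t * ?a u * ?\<phi> u) (at u)" for u
    using has_vector_derivative_exp_levy[of t b \<sigma> u] by (simp only: char[symmetric])
  have a_der: "(?a has_vector_derivative ?a' u) (at u)" for u
    by (rule has_vector_derivative_levy_exponent_deriv)
  have a'_der: "(?a' has_vector_derivative ?a'' u) (at u)" for u
    by (rule has_vector_derivative_levy_exponent_deriv2)
  have m0: "?m 0 = ?\<phi>" by (simp add: char_def fun_eq_iff)
  have m1: "?m 1 = (\<lambda>u. of_real t * ?a u * ?\<phi> u)"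
    using vector_derivative_unique_at[OF m_der[of 0, unfolded m0] \<phi>_der] by (simp add: fun_eq_iff)
  have m2: "?m 2 = (\<lambda>u. (of_real t * ?a' u + of_real t ^ 2 * ?a u ^ 2) * ?\<phi> u)"
  proof
    fix u
    have "((\<lambda>u. of_real t * ?a u * ?\<phi> u) has_vector_derivative
        of_real t * ?a u * (of_real t * ?a u * ?\<phi> u) + of_real t * ?a' u * ?\<phi> u) (at u)"
      by (intro has_vector_derivative_mult has_vector_derivative_mult_right a_der \<phi>_der)
    from vector_derivative_unique_at[OF m_der[of 1 u, unfolded m1] this]
    show "?m 2 u = (of_real t * ?a' u + of_real t ^ 2 * ?a u ^ 2) * ?\<phi> u"
      by (simp add: numeral_2_eq_2 algebra_simps del: of_real_mult)
  qed
  have "((\<lambda>u. (of_real t * ?a' u + of_real t ^ 2 * (?a u * ?a u)) * ?\<phi> u) has_vector_derivative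
      (of_real t * ?a' u + of_real t ^ 2 * (?a u * ?a u)) * (of_real t * ?a u * ?\<phi> u)
      + (of_real t * ?a'' u + of_real t ^ 2 * (?a u * ?a' u + ?a' u * ?a u)) * ?\<phi> u) (at u)"
    by (intro has_vector_derivative_mult has_vector_derivative_mult_right has_vector_derivative_add a_der a'_der \<phi>_der)
  from vector_derivative_unique_at[OF m_der[of 2 u, unfolded m2 power2_eq_square[of "?a _"]] this]
  show ?thesis
    by (simp add: numeral_3_eq_3 numeral_2_eq_2 algebra_simps del: of_real_mult)
qed

text \<open>The mean value theorem between \<open>0\<close> and \<open>u\<close>, as the derivative \<open>t * \<psi>' * char \<mu>\<close> has modulus at most
  \<open>t * cmod \<psi>'\<close> and \<open>\<psi>'\<close> grows at most linearly.\<close>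

lemma char_levy_minus_one_le:
  assumes "real_distribution \<mu>" and char: "\<And>u. char \<mu> u = exp (of_real t * levy_exponent b \<sigma> \<nu> u)"
    and t: "0 \<le> t"
  shows "cmod (char \<mu> u - 1) \<le> t * \<bar>u\<bar> * (\<bar>b\<bar> + levy_curvature \<sigma> \<nu> * \<bar>u\<bar>)"
proof -
  interpret real_distribution \<mu> by fact
  let ?a = "levy_exponent_deriv b \<sigma> \<nu>" and ?K = "\<bar>b\<bar> + levy_curvature \<sigma> \<nu> * \<bar>u\<bar>"
  have der: "(char \<mu> has_vector_derivative of_real t * ?a v * char \<mu> v) (at v)" for v
    using has_vector_derivative_exp_levy[of t b \<sigma> v] by (simp only: char[symmetric])
  have le: "cmod (of_real t * ?a v * char \<mu> v) \<le> t * ?K" if "\<bar>v\<bar> \<le> \<bar>u\<bar>" for v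
  proof -
    have "cmod (?a v) \<le> ?K"
      using norm_levy_exponent_deriv_le[of b \<sigma> v] mult_left_mono[OF that levy_curvature_nonneg[of \<sigma>]] by linarith
    then have "t * cmod (?a v) * cmod (char \<mu> v) \<le> t * ?K * 1"
      using t levy_curvature_nonneg[of \<sigma>] by (intro mult_mono cmod_char_le_1) auto
    then show ?thesis using t by (simp add: norm_mult)
  qed
  have "cmod (char \<mu> u - char \<mu> 0) \<le> t * ?K * norm (u - 0)"
  proof (rule differentiable_bound[where S="{-\<bar>u\<bar>..\<bar>u\<bar>}" and f'="\<lambda>v r. r *\<^sub>R (of_real t * ?a v * char \<mu> v)"])
    show "(char \<mu> has_derivative (\<lambda>r. r *\<^sub>R (of_real t * ?a v * char \<mu> v))) (at v within {-\<bar>u\<bar>..\<bar>u\<bar>})" for v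
      using der[of v] unfolding has_vector_derivative_def by (rule has_derivative_at_withinI)
    show "onorm (\<lambda>r. r *\<^sub>R (of_real t * ?a v * char \<mu> v)) \<le> t * ?K" if "v \<in> {-\<bar>u\<bar>..\<bar>u\<bar>}" for v
    proof (rule onorm_le)
      fix r :: real
      show "norm (r *\<^sub>R (of_real t * ?a v * char \<mu> v)) \<le> t * ?K * norm r"
        using mult_left_mono[OF le[of v], of "\<bar>r\<bar>"] that unfolding norm_scaleR by (simp add: mult_ac abs_le_iff)
    qed
  qed auto
  then show ?thesis by (simp add: char_zero mult_ac)
qed

end

end

section \<open>Bias of the estimator and independence of the increments\<close>

lemma power2_sum3_le: "(x + y + z)\<^sup>2 \<le> 3 * (x\<^sup>2 + y\<^sup>2 + z\<^sup>2)" for x y z :: real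
proof -
  have "0 \<le> (x - y)\<^sup>2 + (y - z)\<^sup>2 + (z - x)\<^sup>2" by simp
  then show ?thesis by (simp add: power2_eq_square algebra_simps)
qed

text \<open>The mean of the estimator at frequency \<open>u\<close> is \<open>(p* + 3 \<i> \<Delta> \<psi>' \<psi>'' + \<i> \<Delta>\<^sup>2 \<psi>'\<^sup>3) \<phi>\<close>, where \<open>p*\<close> is the Fourier
  transform of \<open>p\<close> and \<open>\<phi>\<close> is the characteristic function of an increment. Its distance to \<open>p*\<close> is
  therefore at most the sum of three terms: \<open>\<phi> - 1\<close> times \<open>p*\<close>, and the two error terms of the third
  derivative of \<open>exp (\<Delta> \<psi>)\<close>. Here \<open>K\<close> bounds \<open>\<psi>'\<close> between \<open>0\<close> and \<open>u\<close>, and \<open>c\<close> bounds \<open>\<psi>''\<close>.\<close>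

lemma levy_bias_bound:
  fixes b \<sigma> \<Delta> u :: real and p :: "real \<Rightarrow> complex"
  assumes nu_meas: "\<nu> \<in> borel_measurable borel"
    and nu_nonneg: "\<And>x. 0 \<le> \<nu> x"
    and moment2: "integrable lborel (\<lambda>x. x ^ 2 * \<nu> x)"
    and moment6: "integrable lborel (\<lambda>x. x ^ 6 * \<nu> x)"
    and p_eq: "\<And>x. p x = of_real (x ^ 3 * \<nu> x)"
    and rd: "real_distribution \<mu>"
    and char: "\<And>u. char \<mu> u = exp (of_real \<Delta> * levy_exponent b \<sigma> \<nu> u)"
    and \<Delta>: "\<Delta> > 0"
  defines "c \<equiv> levy_curvature \<sigma> \<nu>"
  defines "K \<equiv> \<bar>b\<bar> + c * \<bar>u\<bar>"
  shows "(cmod (\<i> / of_real \<Delta> * (\<integral>z. iexp (u * z) * (\<i> * of_real z) ^ 3 \<partial>\<mu>) - fourier p u))\<^sup>2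
    \<le> 3 * (\<Delta>\<^sup>2 * u\<^sup>2 * K\<^sup>2 * (cmod (fourier p u))\<^sup>2 + 9 * \<Delta>\<^sup>2 * c\<^sup>2 * K\<^sup>2 + \<Delta> ^ 4 * K ^ 6)"
proof -
  interpret real_distribution \<mu> by fact
  note nu = nu_meas nu_nonneg moment2
  let ?a = "levy_exponent_deriv b \<sigma> \<nu> u" and ?a' = "levy_exponent_deriv2 \<sigma> \<nu> u" and ?\<phi> = "char \<mu> u"
    and ?P = "fourier p u" and ?w = "\<i> / of_real \<Delta> * (\<integral>z. iexp (u * z) * (\<i> * of_real z) ^ 3 \<partial>\<mu>)"
  have a: "cmod ?a \<le> K" and a': "cmod ?a' \<le> c" and \<phi>1: "cmod (?\<phi> - 1) \<le> \<Delta> * \<bar>u\<bar> * K" and c0: "0 \<le> c"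
    unfolding K_def c_def
    using norm_levy_exponent_deriv_le[OF nu] norm_levy_exponent_deriv2_le[OF nu]
      char_levy_minus_one_le[OF nu moment6 rd char] levy_curvature_nonneg[OF nu] \<Delta> by auto
  have K0: "0 \<le> K" using c0 by (simp add: K_def)
  have "(\<integral>x. iexp (u * x) * ((\<i> * of_real x) ^ 3 * of_real (\<nu> x)) \<partial>lborel) = (\<integral>x. - \<i> * (iexp (u * x) * p x) \<partial>lborel)"
  proof (intro Bochner_Integration.integral_cong refl)
    fix x :: real
    have "(\<i> * complex_of_real x) ^ 3 = - \<i> * of_real (x ^ 3)"
    proof -
      have "\<i> ^ 3 = - \<i>" by (simp add: power3_eq_cube)
      then show ?thesis by (simp only: power_mult_distrib of_real_power)
    qed
    then show "iexp (u * x) * ((\<i> * of_real x) ^ 3 * of_real (\<nu> x)) = - \<i> * (iexp (u * x) * p x)"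
      by (simp only: p_eq of_real_mult mult_ac)
  qed
  also have "\<dots> = - \<i> * ?P" unfolding fourier_def by (rule integral_mult_right_zero)
  finally have a'': "(\<integral>x. iexp (u * x) * ((\<i> * of_real x) ^ 3 * of_real (\<nu> x)) \<partial>lborel) = - \<i> * ?P" .
  have "?w - ?P = (?\<phi> - 1) * ?P + 3 * \<i> * of_real \<Delta> * ?a * ?a' * ?\<phi> + \<i> * of_real \<Delta> ^ 2 * ?a ^ 3 * ?\<phi>"
    unfolding third_derivative_levy_marginal[OF nu moment6 rd char] a''
    using \<Delta> by (simp add: field_simps power2_eq_square power3_eq_cube)
  then have "cmod (?w - ?P) \<le> cmod ((?\<phi> - 1) * ?P) + cmod (3 * \<i> * of_real \<Delta> * ?a * ?a' * ?\<phi>) + cmod (\<i> * of_real \<Delta> ^ 2 * ?a ^ 3 * ?\<phi>)"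
    by (simp only:) (intro order.trans[OF norm_triangle_ineq] add_right_mono norm_triangle_ineq)
  also have "\<dots> \<le> \<Delta> * \<bar>u\<bar> * K * cmod ?P + 3 * \<Delta> * c * K + \<Delta>\<^sup>2 * K ^ 3"
  proof (intro add_mono)
    show "cmod ((?\<phi> - 1) * ?P) \<le> \<Delta> * \<bar>u\<bar> * K * cmod ?P"
      unfolding norm_mult by (intro mult_right_mono \<phi>1) auto
    have "3 * \<Delta> * (cmod ?a * cmod ?a') * cmod ?\<phi> \<le> 3 * \<Delta> * (K * c) * 1"
      using \<Delta> a a' K0 c0 by (intro mult_mono cmod_char_le_1) auto
    then show "cmod (3 * \<i> * of_real \<Delta> * ?a * ?a' * ?\<phi>) \<le> 3 * \<Delta> * c * K"
      using \<Delta> by (simp add: norm_mult mult_ac)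
    have "\<Delta>\<^sup>2 * cmod ?a ^ 3 * cmod ?\<phi> \<le> \<Delta>\<^sup>2 * K ^ 3 * 1"
      using a K0 \<Delta> by (intro mult_mono cmod_char_le_1 power_mono) auto
    then show "cmod (\<i> * of_real \<Delta> ^ 2 * ?a ^ 3 * ?\<phi>) \<le> \<Delta>\<^sup>2 * K ^ 3"
      using \<Delta> by (simp add: norm_mult norm_power)
  qed
  finally have "(cmod (?w - ?P))\<^sup>2 \<le> (\<Delta> * \<bar>u\<bar> * K * cmod ?P + 3 * \<Delta> * c * K + \<Delta>\<^sup>2 * K ^ 3)\<^sup>2"
    by (intro power_mono) auto
  also have "\<dots> \<le> 3 * ((\<Delta> * \<bar>u\<bar> * K * cmod ?P)\<^sup>2 + (3 * \<Delta> * c * K)\<^sup>2 + (\<Delta>\<^sup>2 * K ^ 3)\<^sup>2)"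
    by (rule power2_sum3_le)
  also have "\<dots> = 3 * (\<Delta>\<^sup>2 * u\<^sup>2 * K\<^sup>2 * (cmod ?P)\<^sup>2 + 9 * \<Delta>\<^sup>2 * c\<^sup>2 * K\<^sup>2 + \<Delta> ^ 4 * K ^ 6)"
    by (simp add: power_mult_distrib flip: power_mult)
  finally show ?thesis .
qed

text \<open>Only the part with \<open>P\<close>, the modulus of the Fourier transform of \<open>p\<close>, keeps its dependence on \<open>u\<close>. In
  the other two parts \<open>K\<close> is replaced by its largest order of magnitude in the band; \<open>m \<ge> 1\<close> absorbs the constant
  drift \<open>b\<close> into a multiple of \<open>m\<close>.\<close>

lemma levy_bias_bound_cutoff:
  fixes b c u m A P \<Delta> :: real
  assumes c: "0 \<le> c" and m: "1 \<le> m" and u: "\<bar>u\<bar> \<le> pi * m"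
  defines "A \<equiv> \<bar>b\<bar> + c" and "K \<equiv> \<bar>b\<bar> + c * \<bar>u\<bar>"
  shows "3 * (\<Delta>\<^sup>2 * u\<^sup>2 * K\<^sup>2 * P\<^sup>2 + 9 * \<Delta>\<^sup>2 * c\<^sup>2 * K\<^sup>2 + \<Delta> ^ 4 * K ^ 6)
    \<le> 6 * A\<^sup>2 * \<Delta>\<^sup>2 * (u\<^sup>2 * (1 + u\<^sup>2) * P\<^sup>2)
      + (27 * \<Delta>\<^sup>2 * c\<^sup>2 * (A * (2 * pi * m))\<^sup>2 + 3 * \<Delta> ^ 4 * (A * (2 * pi * m)) ^ 6)"
proof -
  have K0: "0 \<le> K" and A0: "0 \<le> A" using c by (auto simp: K_def A_def)
  have KA: "K \<le> A * (1 + \<bar>u\<bar>)"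
    using c by (simp add: K_def A_def algebra_simps)
  have "1 \<le> pi * m" using m pi_ge_two mult_mono[of 1 pi 1 m] by simp
  then have "1 + \<bar>u\<bar> \<le> 2 * pi * m" using u by simp
  then have K1: "K \<le> A * (2 * pi * m)" using KA mult_left_mono[OF _ A0] order.trans by blast
  have "K\<^sup>2 \<le> (A * (1 + \<bar>u\<bar>))\<^sup>2" using KA K0 by (intro power_mono)
  also have "\<dots> \<le> 2 * A\<^sup>2 * (1 + u\<^sup>2)"
  proof -
    have "0 \<le> (1 - \<bar>u\<bar>)\<^sup>2" by simp
    then have "(1 + \<bar>u\<bar>)\<^sup>2 \<le> 2 * (1 + u\<^sup>2)" by (simp add: power2_eq_square algebra_simps)
    from mult_left_mono[OF this zero_le_power2[of A]] show ?thesis by (simp only: power_mult_distrib mult_ac)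
  qed
  finally have "(\<Delta>\<^sup>2 * u\<^sup>2 * P\<^sup>2) * K\<^sup>2 \<le> (\<Delta>\<^sup>2 * u\<^sup>2 * P\<^sup>2) * (2 * A\<^sup>2 * (1 + u\<^sup>2))"
    by (intro mult_left_mono) auto
  moreover have "(9 * \<Delta>\<^sup>2 * c\<^sup>2) * K\<^sup>2 \<le> (9 * \<Delta>\<^sup>2 * c\<^sup>2) * (A * (2 * pi * m))\<^sup>2"
    using K0 K1 by (intro mult_left_mono power_mono) auto
  moreover have "\<Delta> ^ 4 * K ^ 6 \<le> \<Delta> ^ 4 * (A * (2 * pi * m)) ^ 6"
    using K0 K1 by (intro mult_left_mono power_mono) auto
  ultimately show ?thesis by (simp add: mult_ac)
qed

context levy_process
begin

lemma measurable_increment: "0 \<le> \<Delta> \<Longrightarrow> increment L \<Delta> (Suc i) \<in> borel_measurable M"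
  unfolding increment_def[abs_def] using measurable_L[of "real i * \<Delta>"] measurable_L[of "real (Suc i) * \<Delta>"]
  by simp

lemma distr_increment:
  assumes "0 \<le> \<Delta>"
  shows "distr M borel (increment L \<Delta> (Suc i)) = distr M borel (L \<Delta>)"
  using stationary_increments[of "real i * \<Delta>" \<Delta>] assms
  by (simp add: increment_def[abs_def] distrib_right add.commute)

lemma indep_increment:
  assumes "0 < \<Delta>"
  shows "indep_vars (\<lambda>_. borel) (\<lambda>i. increment L \<Delta> (Suc i)) {..<n}"
  using indep_increments[of "\<lambda>i. real i * \<Delta>" n] assms by (simp add: increment_def[abs_def])

end

text \<open>The estimator as a sample mean of independent terms, reindexed from \<open>0\<close> to match the enumeration of
  the independent increments.\<close>

lemma pbar_star_eq:
  "pbar_star L \<Delta> n \<omega> u = 1 / of_nat n *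
     (\<Sum>i<n. \<i> / of_real \<Delta> * (iexp (u * increment L \<Delta> (Suc i) \<omega>) * (\<i> * of_real (increment L \<Delta> (Suc i) \<omega>)) ^ 3))"
proof -
  have "(\<Sum>k = 1..n. (\<i> * of_real (increment L \<Delta> k \<omega>)) ^ 3 * iexp (u * increment L \<Delta> k \<omega>))
      = (\<Sum>i<n. (\<i> * of_real (increment L \<Delta> (Suc i) \<omega>)) ^ 3 * iexp (u * increment L \<Delta> (Suc i) \<omega>))"
    by (rule sum.reindex_bij_witness[of _ Suc "\<lambda>k. k - 1"]) auto
  then show ?thesis
    unfolding pbar_star_def by (simp add: sum_distrib_left mult_ac del: of_real_mult)
qed

lemma continuous_on_pbar_star: "continuous_on UNIV (pbar_star L \<Delta> n \<omega>)"
  unfolding pbar_star_def[abs_def] by (intro continuous_intros)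

section \<open>The risk bound\<close>

theorem proposition4p1:
  fixes M :: "'a measure" and L :: "real \<Rightarrow> 'a \<Rightarrow> real"
    and b \<sigma> :: real and \<nu> :: "real \<Rightarrow> real" and p :: "real \<Rightarrow> complex"
  assumes levy: "levy_process M L"
    and nu_meas: "\<nu> \<in> borel_measurable borel"
    and nu_nonneg: "\<And>x. 0 \<le> \<nu> x"
    and moment2: "integrable lborel (\<lambda>x. x ^ 2 * \<nu> x)"
    and char_L: "\<And>t u. 0 \<le> t \<Longrightarrow>
       char (distr M borel (L t)) u = exp (of_real t * levy_exponent b \<sigma> \<nu> u)"
    and b_mean: "b = (\<integral>\<omega>. L 1 \<omega> \<partial>M)"
    and moment6: "integrable lborel (\<lambda>x. x ^ 6 * \<nu> x)"
    and p_eq: "\<And>x. p x = of_real (x ^ 3 * \<nu> x)"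
    and p_L2: "L2_norm_sq p < \<infinity>"
  shows "\<exists>C::real. C \<ge> 0 \<and> (\<forall>(n::nat) (\<Delta>::real) (m::real). n \<ge> 1 \<longrightarrow> \<Delta> > 0 \<longrightarrow> m \<ge> 1 \<longrightarrow>
     (\<integral>\<^sup>+\<omega>. L2_norm_sq (\<lambda>x. pbar L \<Delta> n m \<omega> x - p x) \<partial>M)
     \<le> L2_norm_sq (\<lambda>x. p x - fourier_inv_cutoff m (fourier p) x)
       + ennreal ((\<integral>\<omega>. increment L \<Delta> 1 \<omega> ^ 6 / \<Delta> \<partial>M) * (m / (real n * \<Delta>))
           + C * (\<Delta>\<^sup>2 * (LBINT u:{- pi * m..pi * m}. u\<^sup>2 * (1 + u\<^sup>2) * (cmod (fourier p u))\<^sup>2)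
                  + \<Delta>\<^sup>2 * m ^ 3 + \<Delta> ^ 4 * m ^ 7)))"
proof -
  interpret levy_process M L by fact
  note nu = nu_meas nu_nonneg moment2
  have [measurable]: "\<nu> \<in> borel_measurable borel" by fact
  have p1: "integrable lborel p"
    using integrable_levy_moment[OF nu moment6, of 3] by (simp add: p_eq[abs_def] del: of_real_mult)
  have fp: "continuous_on UNIV (fourier p)" by (rule continuous_on_fourier[OF p1])
  define c where "c = levy_curvature \<sigma> \<nu>"
  have c0: "0 \<le> c" unfolding c_def by (rule levy_curvature_nonneg[OF nu])
  define A where "A = \<bar>b\<bar> + c"
  have A0: "0 \<le> A" using c0 by (simp add: A_def)
  \<comment> \<open>The three summands are the constants in front of \<open>\<Delta>\<^sup>2\<close> times the integral, \<open>\<Delta>\<^sup>2 * m ^ 3\<close> and \<open>\<Delta> ^ 4 * m ^ 7\<close> that integration of the bias bound produces.\<close>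
  define C where "C = 3 * A\<^sup>2 / pi + 108 * pi\<^sup>2 * c\<^sup>2 * A\<^sup>2 + 192 * pi ^ 6 * A ^ 6"
  have C_ge: "3 * A\<^sup>2 / pi \<le> C" "108 * pi\<^sup>2 * c\<^sup>2 * A\<^sup>2 \<le> C" "192 * pi ^ 6 * A ^ 6 \<le> C" and C0: "0 \<le> C"
    using A0 by (auto simp: C_def)
  show ?thesis
  proof (intro exI[of _ C] conjI allI impI C0)
    fix n :: nat and \<Delta> m :: real
    assume n: "n \<ge> 1" and \<Delta>: "\<Delta> > 0" and m: "m \<ge> 1"
    let ?I = "{- pi * m..pi * m}"
    define \<mu> where "\<mu> = distr M borel (L \<Delta>)"
    have L\<Delta>[measurable]: "L \<Delta> \<in> borel_measurable M" using measurable_L \<Delta> by simp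
    have rd: "real_distribution \<mu>" unfolding \<mu>_def by (rule real_distribution_distr) simp
    have char: "char \<mu> u = exp (of_real \<Delta> * levy_exponent b \<sigma> \<nu> u)" for u
      unfolding \<mu>_def using \<Delta> by (intro char_L) simp
    define Z where "Z i = increment L \<Delta> (Suc i)" for i
    have Zm[measurable]: "Z i \<in> borel_measurable M" for i
      unfolding Z_def using \<Delta> by (intro measurable_increment) simp
    have Zd: "distr M borel (Z i) = \<mu>" for i
      unfolding Z_def \<mu>_def using \<Delta> by (intro distr_increment) simp
    define h where "h u z = \<i> / of_real \<Delta> * (iexp (u * z) * (\<i> * of_real z) ^ 3)" for u z :: real
    have [measurable]: "h u \<in> borel_measurable borel" for u unfolding h_def[abs_def] by measurable
    have pbar: "pbar_star L \<Delta> n \<omega> u = 1 / of_nat n * (\<Sum>i<n. h u (Z i \<omega>))" for \<omega> u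
      unfolding pbar_star_eq h_def Z_def ..
    \<comment> \<open>The second moment of one summand of the estimator, independent of the frequency since \<open>iexp\<close> has modulus one.\<close>
    define s where "s = (\<integral>\<omega>. increment L \<Delta> 1 \<omega> ^ 6 \<partial>M) / \<Delta>\<^sup>2"
    have h2: "(cmod (h u z))\<^sup>2 = z ^ 6 / \<Delta>\<^sup>2" for u z
    proof -
      have "cmod (h u z) = \<bar>z\<bar> ^ 3 / \<Delta>"
        using \<Delta> by (simp add: h_def norm_mult norm_divide norm_power del: of_real_mult)
      then show ?thesis by (simp add: power_divide flip: power_mult)
    qed
    have mom6: "integrable \<mu> (\<lambda>z. z ^ 6)"
      by (rule sixth_moment_levy_marginal[OF nu moment6 rd char])
    have Z6: "integrable M (\<lambda>\<omega>. Z i \<omega> ^ 6)" for i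
      using mom6 unfolding Zd[of i, symmetric] by (subst (asm) integrable_distr_eq) auto
    have Z6s: "(\<integral>\<omega>. Z i \<omega> ^ 6 / \<Delta>\<^sup>2 \<partial>M) = s" for i
    proof -
      have "(\<integral>\<omega>. Z i \<omega> ^ 6 \<partial>M) = (\<integral>z. z ^ 6 \<partial>\<mu>)" for i
        unfolding Zd[of i, symmetric] by (subst integral_distr) auto
      then have "(\<integral>\<omega>. Z i \<omega> ^ 6 \<partial>M) = (\<integral>\<omega>. Z 0 \<omega> ^ 6 \<partial>M)" by simp
      then show ?thesis by (simp add: s_def Z_def)
    qed
    define w where "w u = \<i> / of_real \<Delta> * (\<integral>z. iexp (u * z) * (\<i> * of_real z) ^ 3 \<partial>\<mu>)" for u
    have hw: "expectation (\<lambda>\<omega>. h u (Z i \<omega>)) = w u" for u i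
    proof -
      have "expectation (\<lambda>\<omega>. h u (Z i \<omega>)) = (\<integral>z. h u z \<partial>\<mu>)"
        unfolding Zd[of i, symmetric] by (subst integral_distr) auto
      then show ?thesis unfolding h_def w_def by (simp only: integral_mult_right_zero)
    qed
    have mse: "integrable M (\<lambda>\<omega>. (cmod (pbar_star L \<Delta> n \<omega> u - fourier p u))\<^sup>2)"
      "expectation (\<lambda>\<omega>. (cmod (pbar_star L \<Delta> n \<omega> u - fourier p u))\<^sup>2) \<le> s / real n + (cmod (w u - fourier p u))\<^sup>2" for u
    proof -
      have ind: "indep_vars (\<lambda>_. borel) (\<lambda>i \<omega>. h u (Z i \<omega>)) {..<n}"
        using indep_vars_compose2[OF indep_increment[OF \<Delta>, of n], of "\<lambda>_. h u" "\<lambda>_. borel"]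
        by (simp add: Z_def)
      note mean_square_error_sample_mean[OF ind, of "w u" s "fourier p u"]
      moreover have "integrable M (\<lambda>\<omega>. (cmod (h u (Z i \<omega>)))\<^sup>2)" for i unfolding h2 using Z6 by simp
      moreover have "expectation (\<lambda>\<omega>. (cmod (h u (Z i \<omega>)))\<^sup>2) \<le> s" for i
        unfolding h2 Z6s by simp
      ultimately show "integrable M (\<lambda>\<omega>. (cmod (pbar_star L \<Delta> n \<omega> u - fourier p u))\<^sup>2)"
      "expectation (\<lambda>\<omega>. (cmod (pbar_star L \<Delta> n \<omega> u - fourier p u))\<^sup>2) \<le> s / real n + (cmod (w u - fourier p u))\<^sup>2"
        unfolding pbar using hw n by auto
    qed
    define J where "J u = u\<^sup>2 * (1 + u\<^sup>2) * (cmod (fourier p u))\<^sup>2" for u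
    define r where "r = 27 * \<Delta>\<^sup>2 * c\<^sup>2 * (A * (2 * pi * m))\<^sup>2 + 3 * \<Delta> ^ 4 * (A * (2 * pi * m)) ^ 6"
    have bias: "(cmod (w u - fourier p u))\<^sup>2 \<le> 6 * A\<^sup>2 * \<Delta>\<^sup>2 * J u + r" if "u \<in> ?I" for u
    proof -
      have "\<bar>u\<bar> \<le> pi * m" using that by (auto simp: abs_le_iff)
      from levy_bias_bound_cutoff[OF c0 m this, where b=b and P="cmod (fourier p u)"]
        levy_bias_bound[OF nu moment6 p_eq rd char \<Delta>, of u]
      show ?thesis unfolding w_def J_def r_def A_def c_def by (rule order.trans[rotated])
    qed
    \<comment> \<open>Variance plus squared bias; the variance part \<open>s / real n\<close> does not depend on the frequency.\<close>
    define q where "q u = 6 * A\<^sup>2 * \<Delta>\<^sup>2 * J u + (s / real n + r)" for u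
    have pt: "expectation (\<lambda>\<omega>. (cmod (pbar_star L \<Delta> n \<omega> u - fourier p u))\<^sup>2) \<le> q u" if "u \<in> ?I" for u
      using mse(2)[of u] bias[OF that] by (simp add: q_def)
    have J_int: "set_integrable lborel ?I J"
      unfolding J_def[abs_def]
      by (intro borel_integrable_atLeastAtMost' continuous_intros continuous_on_subset[OF fp]) auto
    have J0: "0 \<le> (LBINT u:?I. J u)"
      unfolding set_lebesgue_integral_def J_def by (intro Bochner_Integration.integral_nonneg) auto
    have const_int: "set_integrable lborel ?I (\<lambda>_. k::real)" for k
      by (intro borel_integrable_atLeastAtMost' continuous_intros)
    have q_int: "set_integrable lborel ?I q"
      unfolding q_def[abs_def] using J_int const_int by (intro set_integral_add set_integrable_mult_right) auto
    have q_eq: "(LBINT u:?I. q u) = 6 * A\<^sup>2 * \<Delta>\<^sup>2 * (LBINT u:?I. J u) + (s / real n + r) * (2 * pi * m)"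
    proof -
      have "(LBINT u:?I. q u) = 6 * A\<^sup>2 * \<Delta>\<^sup>2 * (LBINT u:?I. J u) + (LBINT u:?I. s / real n + r)"
        unfolding q_def using J_int const_int
        by (subst set_integral_add(2)) (auto intro: set_integrable_mult_right simp: set_integral_mult_right)
      also have "(LBINT u:?I. s / real n + r) = (s / real n + r) * (2 * pi * m)"
        using m by (subst set_integral_const) (auto simp: mult.commute)
      finally show ?thesis .
    qed
    let ?N = "L2_norm_sq (\<lambda>x. p x - fourier_inv_cutoff m (fourier p) x)"
    let ?e = "\<lambda>\<omega> u. (cmod (pbar_star L \<Delta> n \<omega> u - fourier p u))\<^sup>2"
    have em: "(\<lambda>(\<omega>, u). ennreal (indicator ?I u * ?e \<omega> u / (2 * pi))) \<in> borel_measurable (M \<Otimes>\<^sub>M lborel)"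
    proof -
      have [measurable]: "fourier p \<in> borel_measurable borel"
        using fp by (rule borel_measurable_continuous_onI)
      show ?thesis unfolding pbar h_def by measurable
    qed
    have split: "L2_norm_sq (\<lambda>x. pbar L \<Delta> n m \<omega> x - p x)
        = ?N + (\<integral>\<^sup>+u. ennreal (indicator ?I u * ?e \<omega> u / (2 * pi)) \<partial>lborel)" for \<omega>
    proof -
      have c: "continuous_on ?I (pbar_star L \<Delta> n \<omega>)" "continuous_on ?I (fourier p)"
        by (auto intro: continuous_on_subset[OF continuous_on_pbar_star] continuous_on_subset[OF fp])
      have "set_integrable lborel ?I (?e \<omega>)"
        by (intro borel_integrable_atLeastAtMost' continuous_intros c)
      then have "integrable lborel (\<lambda>u. indicator ?I u * ?e \<omega> u / (2 * pi))"
        by (simp add: set_integrable_def)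
      then have "(\<integral>\<^sup>+u. ennreal (indicator ?I u * ?e \<omega> u / (2 * pi)) \<partial>lborel)
          = ennreal (\<integral>u. indicator ?I u * ?e \<omega> u / (2 * pi) \<partial>lborel)"
        by (intro nn_integral_eq_integral) auto
      then show ?thesis
        unfolding pbar_def L2_norm_sq_dist_fourier_inv_cutoff[OF p1 p_L2 continuous_on_pbar_star]
        by (simp add: set_lebesgue_integral_def)
    qed
    have "(\<integral>\<^sup>+\<omega>. \<integral>\<^sup>+u. ennreal (indicator ?I u * ?e \<omega> u / (2 * pi)) \<partial>lborel \<partial>M)
        = (\<integral>\<^sup>+u. \<integral>\<^sup>+\<omega>. ennreal (indicator ?I u * ?e \<omega> u / (2 * pi)) \<partial>M \<partial>lborel)"
    proof -
      interpret pair_sigma_finite M lborel ..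
      show ?thesis by (rule Fubini'[OF em, symmetric])
    qed
    also have "\<dots> \<le> (\<integral>\<^sup>+u. ennreal (indicator ?I u * q u / (2 * pi)) \<partial>lborel)"
    proof (rule nn_integral_mono)
      fix u
      have "(\<integral>\<^sup>+\<omega>. ennreal (indicator ?I u * ?e \<omega> u / (2 * pi)) \<partial>M)
          = ennreal (expectation (\<lambda>\<omega>. indicator ?I u * ?e \<omega> u / (2 * pi)))"
        using mse(1) by (intro nn_integral_eq_integral) auto
      also have "expectation (\<lambda>\<omega>. indicator ?I u * ?e \<omega> u / (2 * pi)) = indicator ?I u * expectation (\<lambda>\<omega>. ?e \<omega> u) / (2 * pi)"
        by simp
      also have "ennreal \<dots> \<le> ennreal (indicator ?I u * q u / (2 * pi))"
        using pt[of u] by (intro ennreal_leI divide_right_mono) (auto simp: indicator_def)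
      finally show "(\<integral>\<^sup>+\<omega>. ennreal (indicator ?I u * ?e \<omega> u / (2 * pi)) \<partial>M) \<le> ennreal (indicator ?I u * q u / (2 * pi))" .
    qed
    also have "\<dots> = ennreal (\<integral>u. indicator ?I u * q u / (2 * pi) \<partial>lborel)"
    proof (rule nn_integral_eq_integral)
      show "integrable lborel (\<lambda>u. indicator ?I u * q u / (2 * pi))"
        using q_int by (simp add: set_integrable_def)
      have "0 \<le> q u" if "u \<in> ?I" for u
        by (rule order.trans[OF _ pt[OF that]]) simp
      then show "AE u in lborel. 0 \<le> indicator ?I u * q u / (2 * pi)"
        by (auto simp: indicator_def)
    qed
    also have "(\<integral>u. indicator ?I u * q u / (2 * pi) \<partial>lborel) = (LBINT u:?I. q u) / (2 * pi)"
      by (simp add: set_lebesgue_integral_def)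
    finally have stochastic: "(\<integral>\<^sup>+\<omega>. \<integral>\<^sup>+u. ennreal (indicator ?I u * ?e \<omega> u / (2 * pi)) \<partial>lborel \<partial>M)
        \<le> ennreal ((LBINT u:?I. q u) / (2 * pi))" .
    have "(LBINT u:?I. q u) / (2 * pi) = s / real n * m + (3 * A\<^sup>2 / pi * (\<Delta>\<^sup>2 * (LBINT u:?I. J u)) + r * m)"
      unfolding q_eq by (simp add: field_simps)
    also have "r * m = 108 * pi\<^sup>2 * c\<^sup>2 * A\<^sup>2 * (\<Delta>\<^sup>2 * m ^ 3) + 192 * pi ^ 6 * A ^ 6 * (\<Delta> ^ 4 * m ^ 7)"
      unfolding r_def power_mult_distrib by (simp add: distrib_right eval_nat_numeral)
    also have "s / real n * m + (3 * A\<^sup>2 / pi * (\<Delta>\<^sup>2 * (LBINT u:?I. J u))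
          + (108 * pi\<^sup>2 * c\<^sup>2 * A\<^sup>2 * (\<Delta>\<^sup>2 * m ^ 3) + 192 * pi ^ 6 * A ^ 6 * (\<Delta> ^ 4 * m ^ 7)))
        \<le> s / real n * m + (C * (\<Delta>\<^sup>2 * (LBINT u:?I. J u)) + (C * (\<Delta>\<^sup>2 * m ^ 3) + C * (\<Delta> ^ 4 * m ^ 7)))"
      using C_ge J0 m by (intro add_mono mult_right_mono order.refl) auto
    also have "s / real n * m = (\<integral>\<omega>. increment L \<Delta> 1 \<omega> ^ 6 / \<Delta> \<partial>M) * (m / (real n * \<Delta>))"
      by (simp add: s_def power2_eq_square)
    finally have bound: "(LBINT u:?I. q u) / (2 * pi)
        \<le> (\<integral>\<omega>. increment L \<Delta> 1 \<omega> ^ 6 / \<Delta> \<partial>M) * (m / (real n * \<Delta>))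
          + C * (\<Delta>\<^sup>2 * (LBINT u:?I. u\<^sup>2 * (1 + u\<^sup>2) * (cmod (fourier p u))\<^sup>2) + \<Delta>\<^sup>2 * m ^ 3 + \<Delta> ^ 4 * m ^ 7)"
      unfolding J_def by (simp only: distrib_left add.assoc)
    have "(\<integral>\<^sup>+\<omega>. L2_norm_sq (\<lambda>x. pbar L \<Delta> n m \<omega> x - p x) \<partial>M)
        = ?N + (\<integral>\<^sup>+\<omega>. \<integral>\<^sup>+u. ennreal (indicator ?I u * ?e \<omega> u / (2 * pi)) \<partial>lborel \<partial>M)"
      unfolding split using lborel.borel_measurable_nn_integral[OF em]
      by (subst nn_integral_add) (simp_all add: emeasure_space_1)
    then show "(\<integral>\<^sup>+\<omega>. L2_norm_sq (\<lambda>x. pbar L \<Delta> n m \<omega> x - p x) \<partial>M)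
     \<le> ?N + ennreal ((\<integral>\<omega>. increment L \<Delta> 1 \<omega> ^ 6 / \<Delta> \<partial>M) * (m / (real n * \<Delta>))
           + C * (\<Delta>\<^sup>2 * (LBINT u:?I. u\<^sup>2 * (1 + u\<^sup>2) * (cmod (fourier p u))\<^sup>2)
                  + \<Delta>\<^sup>2 * m ^ 3 + \<Delta> ^ 4 * m ^ 7))"
      using order.trans[OF stochastic ennreal_leI[OF bound]] by (simp only: add_left_mono)
  qed
qed

end
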